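(* Let $R$ be a ring and $M$ a finitely generated $R$-module. If $M$ is torsionless and projective up to grade $2$, then $M$ is projective.
   Context: Rings are unital and not necessarily commutative; modules are left $R$-modules (the statement holds equally for right modules). Torsionless: an $R$-module $M$ is torsionless if it can be embedded into a direct power $R^I=\prod_{i\in I}R$ for some index set $I$. Grade: for an integer $c$, an $R$-module $T$ has grade at least $c$ if $\operatorname{Ext}^i_R(T,R)=0$ for all $0\le i<c$. Projective up to grade $c$: an $R$-module $M$ is projective up to grade $c$ if there exist a projective $R$-module $P$ and an epimorphism $\pi: P\to M$ such that, with $A:=\ker\pi$, there is a submodule $B\le P$ with $A\cap B=0$ and such that $P/(A+B)$ has grade at least $c$. If $M$ is finitely generated, then $P$ is required to be finitely generated. *)

theory Defs
  imports "HOL-Algebra.Module" "HOL-Algebra.AbelCoset" "HOL-Algebra.Elementary_Groups"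
begin

section \<open>Left modules over a ring that need not be commutative\<close>

text \<open>The locale \<^locale>\<open>module\<close> requires a commutative ring of scalars, so it cannot be used here.
  The record \<open>module\<close> is kept; its fields \<open>mult\<close> and \<open>one\<close> have no meaning for a module and are
  left \<open>undefined\<close> in the constructions below.\<close>

locale left_module = R?: ring R + M?: abelian_group M
  for R :: "('r, 'z) ring_scheme" (structure) and M :: "('r, 'm, 'x) module_scheme" (structure) +
  assumes smult_closed [simp, intro]:
      "\<lbrakk>a \<in> carrier R; x \<in> carrier M\<rbrakk> \<Longrightarrow> a \<odot>\<^bsub>M\<^esub> x \<in> carrier M"
    and smult_l_distr:
      "\<lbrakk>a \<in> carrier R; b \<in> carrier R; x \<in> carrier M\<rbrakk> \<Longrightarrow>
      (a \<oplus> b) \<odot>\<^bsub>M\<^esub> x = a \<odot>\<^bsub>M\<^esub> x \<oplus>\<^bsub>M\<^esub> b \<odot>\<^bsub>M\<^esub> x"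
    and smult_r_distr:
      "\<lbrakk>a \<in> carrier R; x \<in> carrier M; y \<in> carrier M\<rbrakk> \<Longrightarrow>
      a \<odot>\<^bsub>M\<^esub> (x \<oplus>\<^bsub>M\<^esub> y) = a \<odot>\<^bsub>M\<^esub> x \<oplus>\<^bsub>M\<^esub> a \<odot>\<^bsub>M\<^esub> y"
    and smult_assoc1:
      "\<lbrakk>a \<in> carrier R; b \<in> carrier R; x \<in> carrier M\<rbrakk> \<Longrightarrow>
      (a \<otimes> b) \<odot>\<^bsub>M\<^esub> x = a \<odot>\<^bsub>M\<^esub> (b \<odot>\<^bsub>M\<^esub> x)"
    and smult_one [simp]:
      "x \<in> carrier M \<Longrightarrow> \<one> \<odot>\<^bsub>M\<^esub> x = x"

text \<open>Linear maps are extensional, so that equal maps are equal as HOL functions and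
  \<open>Hom\<^sub>R(M, N)\<close> is a group with respect to HOL equality.\<close>

definition linear_maps ::
  "('r, 'z) ring_scheme \<Rightarrow> ('r, 'm, 'x) module_scheme \<Rightarrow> ('r, 'n, 'y) module_scheme \<Rightarrow> ('m \<Rightarrow> 'n) set"
where
  "linear_maps R M N = {f \<in> carrier M \<rightarrow>\<^sub>E carrier N.
     (\<forall>x\<in>carrier M. \<forall>y\<in>carrier M. f (x \<oplus>\<^bsub>M\<^esub> y) = f x \<oplus>\<^bsub>N\<^esub> f y) \<and>
     (\<forall>a\<in>carrier R. \<forall>x\<in>carrier M. f (a \<odot>\<^bsub>M\<^esub> x) = a \<odot>\<^bsub>N\<^esub> f x)}"

definition finitely_generated :: "('r, 'z) ring_scheme \<Rightarrow> ('r, 'm, 'x) module_scheme \<Rightarrow> bool"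
where
  "finitely_generated R M \<longleftrightarrow>
     (\<exists>S \<subseteq> carrier M. finite S \<and>
       (\<forall>x\<in>carrier M. \<exists>c \<in> S \<rightarrow> carrier R. x = (\<Oplus>\<^bsub>M\<^esub>s\<in>S. c s \<odot>\<^bsub>M\<^esub> s)))"

definition quotient_module :: "('r, 'm, 'x) module_scheme \<Rightarrow> 'm set \<Rightarrow> ('r, 'm set) module"
where
  "quotient_module M H = \<lparr>carrier = a_rcosets\<^bsub>M\<^esub> H, mult = undefined, one = undefined,
     zero = H, add = (<+>\<^bsub>M\<^esub>), smult = (\<lambda>a S. \<Union>x\<in>S. H +>\<^bsub>M\<^esub> (a \<odot>\<^bsub>M\<^esub> x))\<rparr>"

definition regular_module :: "('r, 'z) ring_scheme \<Rightarrow> ('r, 'r) module"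
where
  "regular_module R = \<lparr>carrier = carrier R, mult = mult R, one = one R,
     zero = zero R, add = add R, smult = mult R\<rparr>"

definition direct_power :: "('r, 'z) ring_scheme \<Rightarrow> 'i set \<Rightarrow> ('r, 'i \<Rightarrow> 'r) module"
where
  "direct_power R I = \<lparr>carrier = I \<rightarrow>\<^sub>E carrier R, mult = undefined, one = undefined,
     zero = (\<lambda>i\<in>I. \<zero>\<^bsub>R\<^esub>), add = (\<lambda>f g. \<lambda>i\<in>I. f i \<oplus>\<^bsub>R\<^esub> g i),
     smult = (\<lambda>a f. \<lambda>i\<in>I. a \<otimes>\<^bsub>R\<^esub> f i)\<rparr>"

text \<open>The type argument is the type from which the index set is taken. A theorem that assumes
  \<open>torsionless TYPE('i) R M\<close> with a type variable \<open>'i\<close> covers every index set.\<close>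

definition torsionless ::
  "'i itself \<Rightarrow> ('r, 'z) ring_scheme \<Rightarrow> ('r, 'm, 'x) module_scheme \<Rightarrow> bool"
where
  "torsionless (_ :: 'i itself) R M \<longleftrightarrow>
     (\<exists>(I :: 'i set) f. f \<in> linear_maps R M (direct_power R I) \<and> inj_on f (carrier M))"


section \<open>Free and projective modules\<close>

text \<open>The free module \<open>R\<^sup>(\<^sup>S\<^sup>)\<close>: finitely supported functions, which are zero outside \<open>S\<close>.\<close>

definition free_module :: "('r, 'z) ring_scheme \<Rightarrow> 'b set \<Rightarrow> ('r, 'b \<Rightarrow> 'r) module"
where
  "free_module R S =
     \<lparr>carrier = {f. (\<forall>x. f x \<in> carrier R) \<and> (\<forall>x. x \<notin> S \<longrightarrow> f x = \<zero>\<^bsub>R\<^esub>) \<and> finite {x. f x \<noteq> \<zero>\<^bsub>R\<^esub>}},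
      mult = undefined, one = undefined,
      zero = (\<lambda>_. \<zero>\<^bsub>R\<^esub>), add = (\<lambda>f g x. f x \<oplus>\<^bsub>R\<^esub> g x), smult = (\<lambda>a f x. a \<otimes>\<^bsub>R\<^esub> f x)\<rparr>"

text \<open>The linear map from a free module to \<open>M\<close> that sends each basis element \<open>x\<close> to \<open>g x\<close>.\<close>

definition linear_extension ::
  "('r, 'z) ring_scheme \<Rightarrow> ('r, 'm, 'x) module_scheme \<Rightarrow> ('b \<Rightarrow> 'm) \<Rightarrow> ('b \<Rightarrow> 'r) \<Rightarrow> 'm"
where
  "linear_extension R M g f = (\<Oplus>\<^bsub>M\<^esub>x\<in>{x. f x \<noteq> \<zero>\<^bsub>R\<^esub>}. f x \<odot>\<^bsub>M\<^esub> g x)"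

text \<open>A module is projective if it is isomorphic to a direct summand of a free module, i.e. a retract
  of one. A basis inside the type of \<open>P\<close> suffices. The lemmas \<open>projective_lifting\<close> and
  \<open>projective_if_lifting\<close> below show that this is the lifting property, and that the choice of
  types is immaterial.\<close>

definition projective :: "('r, 'z) ring_scheme \<Rightarrow> ('r, 'p, 'x) module_scheme \<Rightarrow> bool"
where
  "projective R P \<longleftrightarrow> left_module R P \<and>
     (\<exists>(S :: 'p set). \<exists>s \<in> linear_maps R P (free_module R S). \<exists>r \<in> linear_maps R (free_module R S) P.
        \<forall>x\<in>carrier P. r (s x) = x)"


section \<open>Ext\<close>

text \<open>\<open>Ext\<close> is computed with the standard free resolution
  \<open>\<dots> \<rightarrow> F\<^sub>2 \<rightarrow> F\<^sub>1 \<rightarrow> F\<^sub>0 \<rightarrow> T\<close>, in which \<open>F\<^sub>0\<close> has a basis indexed by the elements of \<open>T\<close> and \<open>F\<^sub>n\<^sub>+\<^sub>1\<close>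
  has a basis indexed by the formal linear combinations of basis elements of \<open>F\<^sub>n\<close> that
  are mapped to zero. A formal linear combination is a list of coefficient-generator pairs; in
  this way the bases of all the \<open>F\<^sub>n\<close> live in one type. Exactness is shown in \<open>augmentation_surj\<close>, \<open>exact_0\<close> and
  \<open>exact_Suc\<close> below.\<close>

datatype ('r, 't) generator = Elem 't | Rel "('r \<times> ('r, 't) generator) list"

fun formal_sum :: "('r, 'z) ring_scheme \<Rightarrow> ('r \<times> 'b) list \<Rightarrow> 'b \<Rightarrow> 'r"
where
  "formal_sum R [] = (\<lambda>_. \<zero>\<^bsub>R\<^esub>)"
| "formal_sum R ((a, x) # l) = (formal_sum R l)(x := a \<oplus>\<^bsub>R\<^esub> formal_sum R l x)"

definition augmentation ::
  "('r, 'z) ring_scheme \<Rightarrow> ('r, 't, 'x) module_scheme \<Rightarrow> (('r, 't) generator \<Rightarrow> 'r) \<Rightarrow> 't"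
where
  "augmentation R T =
     linear_extension R T (\<lambda>x. case x of Elem t \<Rightarrow> t | Rel _ \<Rightarrow> \<zero>\<^bsub>T\<^esub>)"

text \<open>A single function gives all the differentials \<open>F\<^sub>n\<^sub>+\<^sub>1 \<rightarrow> F\<^sub>n\<close>. The value on \<open>Elem t\<close> is
  irrelevant, since \<open>Elem t\<close> is a generator of \<open>F\<^sub>0\<close> only.\<close>

definition differential ::
  "('r, 'z) ring_scheme \<Rightarrow> (('r, 't) generator \<Rightarrow> 'r) \<Rightarrow> (('r, 't) generator \<Rightarrow> 'r)"
where
  "differential R =
     linear_extension R (free_module R UNIV) (\<lambda>x. case x of Elem _ \<Rightarrow> (\<lambda>_. \<zero>\<^bsub>R\<^esub>) | Rel l \<Rightarrow> formal_sum R l)"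

fun generators ::
  "('r, 'z) ring_scheme \<Rightarrow> ('r, 't, 'x) module_scheme \<Rightarrow> nat \<Rightarrow> ('r, 't) generator set"
where
  "generators R T 0 = Elem ` carrier T"
| "generators R T (Suc 0) =
     Rel ` {l. set l \<subseteq> carrier R \<times> generators R T 0 \<and> augmentation R T (formal_sum R l) = \<zero>\<^bsub>T\<^esub>}"
| "generators R T (Suc (Suc n)) =
     Rel ` {l. set l \<subseteq> carrier R \<times> generators R T (Suc n) \<and> differential R (formal_sum R l) = (\<lambda>_. \<zero>\<^bsub>R\<^esub>)}"

abbreviation resolution ::
  "('r, 'z) ring_scheme \<Rightarrow> ('r, 't, 'x) module_scheme \<Rightarrow> nat \<Rightarrow> ('r, ('r, 't) generator \<Rightarrow> 'r) module"
where
  "resolution R T n \<equiv> free_module R (generators R T n)"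

definition hom_group ::
  "('r, 'z) ring_scheme \<Rightarrow> ('r, 'm, 'x) module_scheme \<Rightarrow> ('r, 'n, 'y) module_scheme \<Rightarrow> ('m \<Rightarrow> 'n) monoid"
where
  "hom_group R M N = \<lparr>carrier = linear_maps R M N,
     mult = (\<lambda>f g. \<lambda>x\<in>carrier M. f x \<oplus>\<^bsub>N\<^esub> g x), one = (\<lambda>x\<in>carrier M. \<zero>\<^bsub>N\<^esub>)\<rparr>"

text \<open>The map \<open>Hom(F\<^sub>n, N) \<rightarrow> Hom(F\<^sub>n\<^sub>+\<^sub>1, N)\<close> induced by the differential.\<close>

definition codifferential ::
  "('r, 'z) ring_scheme \<Rightarrow> ('r, 't, 'x) module_scheme \<Rightarrow> nat \<Rightarrow>
   ((('r, 't) generator \<Rightarrow> 'r) \<Rightarrow> 'n) \<Rightarrow> ((('r, 't) generator \<Rightarrow> 'r) \<Rightarrow> 'n)"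
where
  "codifferential R T n \<phi> = compose (carrier (resolution R T (Suc n))) \<phi> (differential R)"

definition cocycles ::
  "('r, 'z) ring_scheme \<Rightarrow> nat \<Rightarrow> ('r, 't, 'x) module_scheme \<Rightarrow> ('r, 'n, 'y) module_scheme \<Rightarrow>
   ((('r, 't) generator \<Rightarrow> 'r) \<Rightarrow> 'n) set"
where
  "cocycles R n T N = kernel (hom_group R (resolution R T n) N)
     (hom_group R (resolution R T (Suc n)) N) (codifferential R T n)"

definition coboundaries ::
  "('r, 'z) ring_scheme \<Rightarrow> nat \<Rightarrow> ('r, 't, 'x) module_scheme \<Rightarrow> ('r, 'n, 'y) module_scheme \<Rightarrow>
   ((('r, 't) generator \<Rightarrow> 'r) \<Rightarrow> 'n) set"
where
  "coboundaries R n T N = (case n of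
     0 \<Rightarrow> {\<one>\<^bsub>hom_group R (resolution R T 0) N\<^esub>}
   | Suc m \<Rightarrow> codifferential R T m ` carrier (hom_group R (resolution R T m) N))"

definition Ext ::
  "('r, 'z) ring_scheme \<Rightarrow> nat \<Rightarrow> ('r, 't, 'x) module_scheme \<Rightarrow> ('r, 'n, 'y) module_scheme \<Rightarrow>
   ((('r, 't) generator \<Rightarrow> 'r) \<Rightarrow> 'n) set monoid"
where
  "Ext R n T N =
     (hom_group R (resolution R T n) N)\<lparr>carrier := cocycles R n T N\<rparr> Mod coboundaries R n T N"


section \<open>Grade\<close>

definition grade_at_least :: "int \<Rightarrow> ('r, 'z) ring_scheme \<Rightarrow> ('r, 't, 'x) module_scheme \<Rightarrow> bool"
where
  "grade_at_least c R T \<longleftrightarrow> (\<forall>i. int i < c \<longrightarrow> trivial_group (Ext R i T (regular_module R)))"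

text \<open>The type argument is the type of the elements of the projective module \<open>P\<close>; as for
  \<open>torsionless\<close>, an assumption with a type variable there covers every \<open>P\<close>.\<close>

definition projective_up_to_grade ::
  "'p itself \<Rightarrow> int \<Rightarrow> ('r, 'z) ring_scheme \<Rightarrow> ('r, 'm, 'x) module_scheme \<Rightarrow> bool"
where
  "projective_up_to_grade (_ :: 'p itself) c R M \<longleftrightarrow>
     (\<exists>(P :: ('r, 'p) module) \<pi> B.
        projective R P \<and>
        (finitely_generated R M \<longrightarrow> finitely_generated R P) \<and>
        \<pi> \<in> linear_maps R P M \<and> \<pi> ` carrier P = carrier M \<and>
        submodule B R P \<and>
        a_kernel P M \<pi> \<inter> B = {\<zero>\<^bsub>P\<^esub>} \<and>
        grade_at_least c R (quotient_module P (a_kernel P M \<pi> <+>\<^bsub>P\<^esub> B)))"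


section \<open>Facts that justify the definitions\<close>

lemma linear_mapsI:
  assumes "f \<in> extensional (carrier M)" "\<And>x. x \<in> carrier M \<Longrightarrow> f x \<in> carrier N"
    "\<And>x y. \<lbrakk>x \<in> carrier M; y \<in> carrier M\<rbrakk> \<Longrightarrow> f (x \<oplus>\<^bsub>M\<^esub> y) = f x \<oplus>\<^bsub>N\<^esub> f y"
    "\<And>a x. \<lbrakk>a \<in> carrier R; x \<in> carrier M\<rbrakk> \<Longrightarrow> f (a \<odot>\<^bsub>M\<^esub> x) = a \<odot>\<^bsub>N\<^esub> f x"
  shows "f \<in> linear_maps R M N"
  using assms by (auto simp: linear_maps_def PiE_def)

lemma linear_mapsD:
  assumes "f \<in> linear_maps R M N"
  shows "f \<in> extensional (carrier M)" "\<And>x. x \<in> carrier M \<Longrightarrow> f x \<in> carrier N"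
    "\<And>x y. \<lbrakk>x \<in> carrier M; y \<in> carrier M\<rbrakk> \<Longrightarrow> f (x \<oplus>\<^bsub>M\<^esub> y) = f x \<oplus>\<^bsub>N\<^esub> f y"
    "\<And>a x. \<lbrakk>a \<in> carrier R; x \<in> carrier M\<rbrakk> \<Longrightarrow> f (a \<odot>\<^bsub>M\<^esub> x) = a \<odot>\<^bsub>N\<^esub> f x"
  using assms by (auto simp: linear_maps_def PiE_def Pi_def)

context left_module
begin

lemma smult_l_null [simp]: "x \<in> carrier M \<Longrightarrow> \<zero> \<odot>\<^bsub>M\<^esub> x = \<zero>\<^bsub>M\<^esub>"
  using smult_l_distr[of \<zero> \<zero> x] by (metis M.add.r_cancel_one' R.l_zero R.zero_closed smult_closed)

lemma smult_r_null [simp]: "a \<in> carrier R \<Longrightarrow> a \<odot>\<^bsub>M\<^esub> \<zero>\<^bsub>M\<^esub> = \<zero>\<^bsub>M\<^esub>"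
  using smult_r_distr[of a "\<zero>\<^bsub>M\<^esub>" "\<zero>\<^bsub>M\<^esub>"] by (metis M.add.r_cancel_one' M.l_zero M.zero_closed smult_closed)

lemma smult_finsum:
  "\<lbrakk>a \<in> carrier R; f \<in> A \<rightarrow> carrier M\<rbrakk> \<Longrightarrow>
     a \<odot>\<^bsub>M\<^esub> (\<Oplus>\<^bsub>M\<^esub>i\<in>A. f i) = (\<Oplus>\<^bsub>M\<^esub>i\<in>A. a \<odot>\<^bsub>M\<^esub> f i)"
proof (induct A rule: infinite_finite_induct)
  case (insert x F) then show ?case by (simp add: Pi_def smult_r_distr)
qed auto

lemma left_module_axiom: "left_module R M" ..

end

lemma left_moduleI:
  fixes R (structure) and M (structure)
  assumes "ring R" "\<And>x y. \<lbrakk>x \<in> carrier M; y \<in> carrier M\<rbrakk> \<Longrightarrow> x \<oplus>\<^bsub>M\<^esub> y \<in> carrier M"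
    "\<zero>\<^bsub>M\<^esub> \<in> carrier M"
    "\<And>x y z. \<lbrakk>x \<in> carrier M; y \<in> carrier M; z \<in> carrier M\<rbrakk> \<Longrightarrow> (x \<oplus>\<^bsub>M\<^esub> y) \<oplus>\<^bsub>M\<^esub> z = x \<oplus>\<^bsub>M\<^esub> (y \<oplus>\<^bsub>M\<^esub> z)"
    "\<And>x y. \<lbrakk>x \<in> carrier M; y \<in> carrier M\<rbrakk> \<Longrightarrow> x \<oplus>\<^bsub>M\<^esub> y = y \<oplus>\<^bsub>M\<^esub> x"
    "\<And>x. x \<in> carrier M \<Longrightarrow> \<zero>\<^bsub>M\<^esub> \<oplus>\<^bsub>M\<^esub> x = x"
    "\<And>x. x \<in> carrier M \<Longrightarrow> \<exists>y\<in>carrier M. y \<oplus>\<^bsub>M\<^esub> x = \<zero>\<^bsub>M\<^esub>"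
    "\<And>a x. \<lbrakk>a \<in> carrier R; x \<in> carrier M\<rbrakk> \<Longrightarrow> a \<odot>\<^bsub>M\<^esub> x \<in> carrier M"
    "\<And>a b x. \<lbrakk>a \<in> carrier R; b \<in> carrier R; x \<in> carrier M\<rbrakk> \<Longrightarrow>
      (a \<oplus> b) \<odot>\<^bsub>M\<^esub> x = (a \<odot>\<^bsub>M\<^esub> x) \<oplus>\<^bsub>M\<^esub> (b \<odot>\<^bsub>M\<^esub> x)"
    "\<And>a x y. \<lbrakk>a \<in> carrier R; x \<in> carrier M; y \<in> carrier M\<rbrakk> \<Longrightarrow>
      a \<odot>\<^bsub>M\<^esub> (x \<oplus>\<^bsub>M\<^esub> y) = (a \<odot>\<^bsub>M\<^esub> x) \<oplus>\<^bsub>M\<^esub> (a \<odot>\<^bsub>M\<^esub> y)"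
    "\<And>a b x. \<lbrakk>a \<in> carrier R; b \<in> carrier R; x \<in> carrier M\<rbrakk> \<Longrightarrow>
      (a \<otimes> b) \<odot>\<^bsub>M\<^esub> x = a \<odot>\<^bsub>M\<^esub> (b \<odot>\<^bsub>M\<^esub> x)"
    "\<And>x. x \<in> carrier M \<Longrightarrow> \<one> \<odot>\<^bsub>M\<^esub> x = x"
  shows "left_module R M"
proof -
  have "abelian_group M" by (rule abelian_groupI) (use assms in auto)
  with assms show ?thesis by (auto intro!: left_module.intro left_module_axioms.intro)
qed

lemma linear_maps_zero:
  assumes "left_module R M" "left_module R N" "f \<in> linear_maps R M N"
  shows "f \<zero>\<^bsub>M\<^esub> = \<zero>\<^bsub>N\<^esub>"
proof -
  interpret M: left_module R M by fact
  interpret N: left_module R N by fact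
  have "f (\<zero>\<^bsub>R\<^esub> \<odot>\<^bsub>M\<^esub> \<zero>\<^bsub>M\<^esub>) = \<zero>\<^bsub>R\<^esub> \<odot>\<^bsub>N\<^esub> f \<zero>\<^bsub>M\<^esub>"
    by (rule linear_mapsD(4)[OF assms(3)]) auto
  then show ?thesis using linear_mapsD(2)[OF assms(3)] by simp
qed

lemma linear_maps_finsum:
  assumes "left_module R M" "left_module R N" "f \<in> linear_maps R M N" "h \<in> A \<rightarrow> carrier M"
  shows "f (\<Oplus>\<^bsub>M\<^esub>x\<in>A. h x) = (\<Oplus>\<^bsub>N\<^esub>x\<in>A. f (h x))"
proof -
  interpret M: left_module R M by fact
  interpret N: left_module R N by fact
  note D = linear_mapsD[OF assms(3)]
  show ?thesis using assms(4)
  proof (induct A rule: infinite_finite_induct)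
    case (insert x F) then show ?case by (simp add: Pi_def D)
  qed (auto simp: linear_maps_zero[OF assms(1-3)])
qed

lemma linear_maps_compose:
  assumes "f \<in> linear_maps R M N" "g \<in> linear_maps R N K"
    "left_module R M"
  shows "compose (carrier M) g f \<in> linear_maps R M K"
proof -
  interpret M: left_module R M by fact
  show ?thesis by (rule linear_mapsI) 
    (auto simp: compose_def linear_mapsD[OF assms(1)] linear_mapsD[OF assms(2)])
qed

lemma left_module_regular_module: assumes "ring R" shows "left_module R (regular_module R)"
proof -
  interpret ring R by fact
  have "\<exists>y\<in>carrier R. y \<oplus>\<^bsub>R\<^esub> x = \<zero>\<^bsub>R\<^esub>" if "x \<in> carrier R" for x
    using that l_neg[of x] by blast
  then show ?thesis
    by (intro left_moduleI) (auto simp: regular_module_def l_distr r_distr m_assoc a_ac assms)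
qed

lemma left_module_direct_power: assumes "ring R" shows "left_module R (direct_power R I)"
proof -
  interpret ring R by fact
  have inv: "\<exists>y\<in>I \<rightarrow>\<^sub>E carrier R. (\<lambda>i\<in>I. y i \<oplus>\<^bsub>R\<^esub> x i) = (\<lambda>i\<in>I. \<zero>\<^bsub>R\<^esub>)" if "x \<in> I \<rightarrow>\<^sub>E carrier R" for x
    by (rule bexI[of _ "\<lambda>i\<in>I. \<ominus>\<^bsub>R\<^esub> x i"]) (use that in \<open>auto simp: l_neg PiE_def Pi_def fun_eq_iff\<close>)
  show ?thesis
    by (rule left_moduleI)
      (use inv in \<open>auto simp: direct_power_def assms\<close>,
       auto simp: l_distr r_distr m_assoc a_ac fun_eq_iff PiE_def Pi_def extensional_def)
qed

lemma left_module_free_module: assumes "ring R" shows "left_module R (free_module R S)"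
proof -
  interpret ring R by fact
  have f1: "finite {x. f x \<oplus>\<^bsub>R\<^esub> g x \<noteq> \<zero>\<^bsub>R\<^esub>}" if "finite {x. f x \<noteq> \<zero>\<^bsub>R\<^esub>}" "finite {x. g x \<noteq> \<zero>\<^bsub>R\<^esub>}" for f g
    by (rule finite_subset[OF _ finite_UnI[OF that]]) auto
  have f2: "finite {x. a \<otimes>\<^bsub>R\<^esub> f x \<noteq> \<zero>\<^bsub>R\<^esub>}" if "finite {x. f x \<noteq> \<zero>\<^bsub>R\<^esub>}" "a \<in> carrier R" for f a
    by (rule finite_subset[OF _ that(1)]) (use that in auto)
  have inv: "\<exists>y\<in>carrier (free_module R S). y \<oplus>\<^bsub>free_module R S\<^esub> f = \<zero>\<^bsub>free_module R S\<^esub>"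
    if f: "f \<in> carrier (free_module R S)" for f
  proof (rule bexI[of _ "\<lambda>i. \<ominus>\<^bsub>R\<^esub> f i"])
    show "(\<lambda>i. \<ominus>\<^bsub>R\<^esub> f i) \<oplus>\<^bsub>free_module R S\<^esub> f = \<zero>\<^bsub>free_module R S\<^esub>"
      using f by (auto simp: free_module_def l_neg)
    have "{x. \<ominus>\<^bsub>R\<^esub> f x \<noteq> \<zero>\<^bsub>R\<^esub>} \<subseteq> {x. f x \<noteq> \<zero>\<^bsub>R\<^esub>}" by auto
    then show "(\<lambda>i. \<ominus>\<^bsub>R\<^esub> f i) \<in> carrier (free_module R S)"
      using f by (auto simp: free_module_def intro: finite_subset)
  qed
  show ?thesis
    by (rule left_moduleI)
      (use inv in \<open>auto simp: free_module_def assms f1 f2 l_distr r_distr m_assoc a_assoc fun_eq_iff\<close>,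
       auto simp: a_comm)
qed

lemma free_module_mono: "S \<subseteq> S' \<Longrightarrow> carrier (free_module R S) \<subseteq> carrier (free_module R S')"
  by (auto simp: free_module_def)

lemma linear_extension_eq:
  assumes "left_module R M" "f \<in> carrier (free_module R S)" "g \<in> S \<rightarrow> carrier M"
    "finite A" "A \<subseteq> S" "{x. f x \<noteq> \<zero>\<^bsub>R\<^esub>} \<subseteq> A"
  shows "linear_extension R M g f = (\<Oplus>\<^bsub>M\<^esub>x\<in>A. f x \<odot>\<^bsub>M\<^esub> g x)"
proof -
  interpret left_module R M by fact
  show ?thesis unfolding linear_extension_def
    by (rule add.finprod_mono_neutral_cong_left) (use assms in \<open>auto simp: free_module_def Pi_def\<close>)
qed

lemma linear_extension_closed:
  assumes "left_module R M" "f \<in> carrier (free_module R S)" "g \<in> S \<rightarrow> carrier M"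
  shows "linear_extension R M g f \<in> carrier M"
proof -
  interpret left_module R M by fact
  show ?thesis unfolding linear_extension_def
    by (rule finsum_closed) (use assms in \<open>auto simp: free_module_def Pi_def\<close>)
qed

lemma linear_extension_add:
  assumes "left_module R M" "f \<in> carrier (free_module R S)" "f' \<in> carrier (free_module R S)" "g \<in> S \<rightarrow> carrier M"
  shows "linear_extension R M g (f \<oplus>\<^bsub>free_module R S\<^esub> f') = linear_extension R M g f \<oplus>\<^bsub>M\<^esub> linear_extension R M g f'"
proof -
  interpret left_module R M by fact
  interpret F: left_module R "free_module R S" by (rule left_module_free_module) (rule R.ring_axioms)
  let ?A = "{x. f x \<noteq> \<zero>\<^bsub>R\<^esub>} \<union> {x. f' x \<noteq> \<zero>\<^bsub>R\<^esub>}"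
  have A: "finite ?A" "?A \<subseteq> S" using assms by (auto simp: free_module_def)
  have c: "f x \<in> carrier R" "f' x \<in> carrier R" for x using assms by (auto simp: free_module_def)
  have gA: "g x \<in> carrier M" if "x \<in> ?A" for x using funcset_mem[OF assms(4)] A(2) that by blast
  have s: "{x. (f \<oplus>\<^bsub>free_module R S\<^esub> f') x \<noteq> \<zero>\<^bsub>R\<^esub>} \<subseteq> ?A" by (auto simp: free_module_def)
  note e = linear_extension_eq[OF assms(1) _ assms(4) A]
  have "(\<Oplus>\<^bsub>M\<^esub>x\<in>?A. (f \<oplus>\<^bsub>free_module R S\<^esub> f') x \<odot>\<^bsub>M\<^esub> g x) = (\<Oplus>\<^bsub>M\<^esub>x\<in>?A. (f x \<odot>\<^bsub>M\<^esub> g x) \<oplus>\<^bsub>M\<^esub> (f' x \<odot>\<^bsub>M\<^esub> g x))"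
    by (rule finsum_cong') (use assms c A in \<open>auto simp: free_module_def smult_l_distr Pi_def\<close>)
  also have "\<dots> = (\<Oplus>\<^bsub>M\<^esub>x\<in>?A. f x \<odot>\<^bsub>M\<^esub> g x) \<oplus>\<^bsub>M\<^esub> (\<Oplus>\<^bsub>M\<^esub>x\<in>?A. f' x \<odot>\<^bsub>M\<^esub> g x)"
    by (rule finsum_addf) (use gA c in auto)
  finally show ?thesis using assms(2,3) s by (simp add: e)
qed

lemma linear_extension_smult:
  assumes "left_module R M" "f \<in> carrier (free_module R S)" "a \<in> carrier R" "g \<in> S \<rightarrow> carrier M"
  shows "linear_extension R M g (a \<odot>\<^bsub>free_module R S\<^esub> f) = a \<odot>\<^bsub>M\<^esub> linear_extension R M g f"
proof -
  interpret left_module R M by fact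
  interpret F: left_module R "free_module R S" by (rule left_module_free_module) (rule R.ring_axioms)
  let ?A = "{x. f x \<noteq> \<zero>\<^bsub>R\<^esub>}"
  have A: "finite ?A" "?A \<subseteq> S" using assms by (auto simp: free_module_def)
  have c: "f x \<in> carrier R" for x using assms by (auto simp: free_module_def)
  have gA: "g x \<in> carrier M" if "x \<in> ?A" for x using funcset_mem[OF assms(4)] A(2) that by blast
  have s: "{x. (a \<odot>\<^bsub>free_module R S\<^esub> f) x \<noteq> \<zero>\<^bsub>R\<^esub>} \<subseteq> ?A" using assms by (auto simp: free_module_def)
  note e = linear_extension_eq[OF assms(1) _ assms(4) A]
  have "(\<Oplus>\<^bsub>M\<^esub>x\<in>?A. (a \<odot>\<^bsub>free_module R S\<^esub> f) x \<odot>\<^bsub>M\<^esub> g x) = (\<Oplus>\<^bsub>M\<^esub>x\<in>?A. a \<odot>\<^bsub>M\<^esub> (f x \<odot>\<^bsub>M\<^esub> g x))"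
    by (rule finsum_cong') (use assms c A in \<open>auto simp: free_module_def smult_assoc1 Pi_def\<close>)
  also have "\<dots> = a \<odot>\<^bsub>M\<^esub> (\<Oplus>\<^bsub>M\<^esub>x\<in>?A. f x \<odot>\<^bsub>M\<^esub> g x)"
    by (rule smult_finsum[symmetric]) (use assms(3) gA c in auto)
  finally show ?thesis using assms(2,3) s by (simp add: e)
qed

lemma linear_extension_linear:
  assumes "left_module R M" "g \<in> S \<rightarrow> carrier M"
  shows "restrict (linear_extension R M g) (carrier (free_module R S)) \<in> linear_maps R (free_module R S) M"
proof -
  interpret left_module R M by fact
  interpret F: left_module R "free_module R S" by (rule left_module_free_module) (rule R.ring_axioms)
  show ?thesis by (rule linear_mapsI)
    (use assms in \<open>simp_all add: linear_extension_closed linear_extension_add linear_extension_smult\<close>)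
qed

definition basis :: "('r, 'z) ring_scheme \<Rightarrow> 'b \<Rightarrow> 'b \<Rightarrow> 'r" where
  "basis R x = (\<lambda>y. if y = x then \<one>\<^bsub>R\<^esub> else \<zero>\<^bsub>R\<^esub>)"

lemma basis_closed: "ring R \<Longrightarrow> x \<in> S \<Longrightarrow> basis R x \<in> carrier (free_module R S)"
  by (auto simp: basis_def free_module_def ring.ring_simprules intro: finite_subset[of _ "{x}"])

lemma linear_extension_basis:
  assumes "left_module R M" "g \<in> S \<rightarrow> carrier M" "x \<in> S"
  shows "linear_extension R M g (basis R x) = g x"
proof -
  interpret left_module R M by fact
  have "linear_extension R M g (basis R x) = (\<Oplus>\<^bsub>M\<^esub>y\<in>{x}. basis R x y \<odot>\<^bsub>M\<^esub> g y)"
    by (rule linear_extension_eq[OF assms(1) basis_closed[OF R.ring_axioms assms(3)] assms(2)])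
      (use assms in \<open>auto simp: basis_def\<close>)
  also have "\<dots> = g x" using funcset_mem[OF assms(2,3)] by (subst finsum_insert) (auto simp: basis_def)
  finally show ?thesis .
qed

lemma formal_sum_closed:
  assumes "ring R" "set l \<subseteq> carrier R \<times> S"
  shows "formal_sum R l \<in> carrier (free_module R S)"
  using assms(2)
proof (induct l)
  case Nil then show ?case using assms(1) by (auto simp: free_module_def ring.ring_simprules)
next
  case (Cons p l)
  obtain a x where [simp]: "p = (a, x)" by (cases p)
  interpret ring R by fact
  have h: "formal_sum R l \<in> carrier (free_module R S)" using Cons by auto
  have "finite {y. formal_sum R (p # l) y \<noteq> \<zero>\<^bsub>R\<^esub>}"
    by (rule finite_subset[of _ "insert x {y. formal_sum R l y \<noteq> \<zero>\<^bsub>R\<^esub>}"])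
      (use h in \<open>auto simp: free_module_def\<close>)
  then show ?case using h Cons.prems by (auto simp: free_module_def)
qed

lemma formal_sum_Cons:
  assumes "ring R" "a \<in> carrier R" "x \<in> S" "set l \<subseteq> carrier R \<times> S"
  shows "formal_sum R ((a,x)#l) =
    (a \<odot>\<^bsub>free_module R S\<^esub> basis R x) \<oplus>\<^bsub>free_module R S\<^esub> formal_sum R l"
proof -
  interpret ring R by fact
  have "formal_sum R l y \<in> carrier R" for y
    using formal_sum_closed[OF assms(1,4)] by (auto simp: free_module_def)
  then show ?thesis using assms by (auto simp: fun_eq_iff free_module_def basis_def)
qed

lemma formal_sum_surj:
  assumes "ring R" "f \<in> carrier (free_module R S)"
  shows "\<exists>l. set l \<subseteq> carrier R \<times> S \<and> formal_sum R l = f"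
proof -
  interpret ring R by fact
  have "finite A \<Longrightarrow> f \<in> carrier (free_module R S) \<Longrightarrow> {x. f x \<noteq> \<zero>\<^bsub>R\<^esub>} = A \<Longrightarrow> ?thesis" for A
  proof (induct A arbitrary: f rule: finite_induct)
    case empty then show ?case by (intro exI[of _ "[]"]) auto
  next
    case (insert x A)
    let ?f = "f(x := \<zero>\<^bsub>R\<^esub>)"
    have e: "{y. ?f y \<noteq> \<zero>\<^bsub>R\<^esub>} = A" using insert by auto
    then have "?f \<in> carrier (free_module R S)" using insert by (auto simp: free_module_def)
    then obtain l where l: "set l \<subseteq> carrier R \<times> S" "formal_sum R l = ?f" using insert e by blast
    have "f x \<in> carrier R" "x \<in> S" using insert.prems by (auto simp: free_module_def)
    then show ?case using l by (intro exI[of _ "(f x, x) # l"]) auto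
  qed
  then show ?thesis using assms by (auto simp: free_module_def)
qed

lemma generators_Suc_subset: "generators R T (Suc n) \<subseteq> range Rel"
  by (cases n) auto

lemma generators_Rel:
  "ring R \<Longrightarrow> Rel l \<in> generators R T (Suc n) \<Longrightarrow> formal_sum R l \<in> carrier (resolution R T n)"
  by (cases n) (auto intro!: formal_sum_closed)

abbreviation (input) "relval R \<equiv> (\<lambda>x. case x of Elem _ \<Rightarrow> (\<lambda>_. \<zero>\<^bsub>R\<^esub>) | Rel l \<Rightarrow> formal_sum R l)"

lemma finsum_free_module:
  fixes S :: "'b set"
  assumes "ring R" "h \<in> A \<rightarrow> carrier (free_module R S)"
  shows "finsum (free_module R UNIV) h A = finsum (free_module R S) h A"
proof -
  interpret F: left_module R "free_module R S" by (rule left_module_free_module) fact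
  interpret U: left_module R "free_module R (UNIV :: 'b set)" by (rule left_module_free_module) fact
  have ops: "add (free_module R UNIV) = add (free_module R S)" "zero (free_module R UNIV) = zero (free_module R S)"
    by (simp_all add: free_module_def)
  have sub: "x \<in> carrier (free_module R UNIV)" if "x \<in> carrier (free_module R S)" for x
    using free_module_mono[of S UNIV R] that by blast
  show ?thesis using assms(2)
  proof (induct A rule: infinite_finite_induct)
    case (insert x A)
    then have c: "h \<in> A \<rightarrow> carrier (free_module R S)" "h x \<in> carrier (free_module R S)" by auto
    then have "h \<in> A \<rightarrow> carrier (free_module R UNIV)" using sub by blast
    moreover have "h x \<in> carrier (free_module R UNIV)" using sub c by blast
    ultimately show ?case
      using insert(3)[OF c(1)] F.finsum_insert[OF insert(1,2) c] U.finsum_insert[OF insert(1,2)] by (simp add: ops)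
  qed (simp_all add: ops)
qed

lemma differential_eq:
  assumes "ring R" "f \<in> carrier (resolution R T (Suc n))"
  shows "differential R f = linear_extension R (resolution R T n) (relval R) f"
proof -
  interpret ring R by fact
  interpret F: left_module R "resolution R T n" by (rule left_module_free_module) fact
  have "differential R f = (\<Oplus>\<^bsub>free_module R UNIV\<^esub>x\<in>{x. f x \<noteq> \<zero>\<^bsub>R\<^esub>}. f x \<odot>\<^bsub>resolution R T n\<^esub> relval R x)"
    by (simp add: differential_def linear_extension_def) (simp add: free_module_def)
  also have "\<dots> = (\<Oplus>\<^bsub>resolution R T n\<^esub>x\<in>{x. f x \<noteq> \<zero>\<^bsub>R\<^esub>}. f x \<odot>\<^bsub>resolution R T n\<^esub> relval R x)"
  proof (rule finsum_free_module[OF assms(1)], rule)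
    fix x assume "x \<in> {x. f x \<noteq> \<zero>\<^bsub>R\<^esub>}"
    then have "x \<in> generators R T (Suc n)" "f x \<in> carrier R" using assms(2) by (auto simp: free_module_def)
    moreover then obtain l where "x = Rel l" using generators_Suc_subset by blast
    ultimately show "f x \<odot>\<^bsub>resolution R T n\<^esub> relval R x \<in> carrier (resolution R T n)"
      using generators_Rel[OF assms(1)] by auto
  qed
  finally show ?thesis by (simp add: linear_extension_def)
qed

lemma relval_Pi: "ring R \<Longrightarrow> relval R \<in> generators R T (Suc n) \<rightarrow> carrier (resolution R T n)"
  using generators_Suc_subset[of R T n] generators_Rel[of R _ T n] by (fastforce split: generator.split)

lemma differential_linear:
  assumes "ring R"
  shows "restrict (differential R) (carrier (resolution R T (Suc n))) \<in> linear_maps R (resolution R T (Suc n)) (resolution R T n)"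
proof -
  have "restrict (differential R) (carrier (resolution R T (Suc n))) = restrict (linear_extension R (resolution R T n) (relval R)) (carrier (resolution R T (Suc n)))"
    by (rule restrict_ext) (rule differential_eq[OF assms])
  then show ?thesis using linear_extension_linear[OF left_module_free_module[OF assms] relval_Pi[OF assms]] by metis
qed

abbreviation (input) "elemval T \<equiv> (\<lambda>x. case x of Elem t \<Rightarrow> t | Rel _ \<Rightarrow> \<zero>\<^bsub>T\<^esub>)"

lemma augmentation_linear:
  assumes "left_module R T"
  shows "restrict (augmentation R T) (carrier (resolution R T 0)) \<in> linear_maps R (resolution R T 0) T"
  unfolding augmentation_def
  by (rule linear_extension_linear[OF assms]) auto

lemma augmentation_surj:
  assumes "left_module R T" shows "augmentation R T ` carrier (resolution R T 0) = carrier T"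
proof -
  interpret left_module R T by fact
  have g: "elemval T \<in> generators R T 0 \<rightarrow> carrier T" by auto
  have "t \<in> augmentation R T ` carrier (resolution R T 0)" if "t \<in> carrier T" for t
    unfolding augmentation_def
    by (rule image_eqI[OF _ basis_closed[OF R.ring_axioms, of "Elem t"]])
      (use linear_extension_basis[OF assms g, of "Elem t"] that in auto)
  then show ?thesis using linear_extension_closed[OF assms _ g] unfolding augmentation_def by auto
qed

lemma differential_basis:
  assumes "ring R" "Rel l \<in> generators R T (Suc n)"
  shows "differential R (basis R (Rel l)) = formal_sum R l"
  using linear_extension_basis[OF left_module_free_module[OF assms(1)] relval_Pi[OF assms(1)] assms(2)]
  by (simp add: differential_eq[OF assms(1) basis_closed[OF assms]])

lemma image_le_kernel_gen:
  assumes "left_module R N" "h \<in> linear_maps R (resolution R T n) N"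
    "\<And>l. Rel l \<in> generators R T (Suc n) \<Longrightarrow> h (formal_sum R l) = \<zero>\<^bsub>N\<^esub>"
    "f \<in> carrier (resolution R T (Suc n))"
  shows "h (differential R f) = \<zero>\<^bsub>N\<^esub>"
proof -
  interpret N: left_module R N by fact
  note r = N.R.ring_axioms
  interpret F: left_module R "resolution R T n" by (rule left_module_free_module) fact
  let ?A = "{x. f x \<noteq> \<zero>\<^bsub>R\<^esub>}"
  have A: "x \<in> generators R T (Suc n)" "f x \<in> carrier R" if "x \<in> ?A" for x using that assms(4) by (auto simp: free_module_def)
  have c: "relval R x \<in> carrier (resolution R T n)" if "x \<in> ?A" for x
    using relval_Pi[OF r, of T n] A(1)[OF that] by blast
  have z: "h (relval R x) = \<zero>\<^bsub>N\<^esub>" if "x \<in> ?A" for x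
    using A(1)[OF that] generators_Suc_subset[of R T n] assms(3) by (auto split: generator.split)
  have "h (differential R f) = h (\<Oplus>\<^bsub>resolution R T n\<^esub>x\<in>?A. f x \<odot>\<^bsub>resolution R T n\<^esub> relval R x)"
    by (simp add: differential_eq[OF r assms(4)] linear_extension_def)
  also have "\<dots> = (\<Oplus>\<^bsub>N\<^esub>x\<in>?A. h (f x \<odot>\<^bsub>resolution R T n\<^esub> relval R x))"
    by (rule linear_maps_finsum[OF F.left_module_axiom assms(1,2)]) (use A c in auto)
  also have "\<dots> = (\<Oplus>\<^bsub>N\<^esub>x\<in>?A. \<zero>\<^bsub>N\<^esub>)"
    by (rule N.finsum_cong') (use A c z in \<open>auto simp: linear_mapsD(4)[OF assms(2)]\<close>)
  finally show ?thesis by simp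
qed

lemma kernel_le_image:
  assumes "ring R" "f \<in> carrier (resolution R T n)"
    "\<And>l. set l \<subseteq> carrier R \<times> generators R T n \<Longrightarrow> formal_sum R l = f \<Longrightarrow> Rel l \<in> generators R T (Suc n)"
  shows "f \<in> differential R ` carrier (resolution R T (Suc n))"
proof -
  obtain l where l: "set l \<subseteq> carrier R \<times> generators R T n" "formal_sum R l = f"
    using formal_sum_surj[OF assms(1,2)] by blast
  have "Rel l \<in> generators R T (Suc n)" using assms(3) l by blast
  then show ?thesis using differential_basis[OF assms(1)] basis_closed[OF assms(1)] l(2) by (metis image_eqI)
qed

lemma exact_0:
  assumes "left_module R T"
  shows "differential R ` carrier (resolution R T (Suc 0)) =
    {f \<in> carrier (resolution R T 0). augmentation R T f = \<zero>\<^bsub>T\<^esub>}" (is "?L = ?R")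
proof -
  interpret T: left_module R T by fact
  note r = T.R.ring_axioms
  note d = linear_mapsD(2)[OF differential_linear[OF r]]
  have "?L \<subseteq> ?R"
  proof clarify
    fix f assume f: "f \<in> carrier (resolution R T (Suc 0))"
    then have c: "differential R f \<in> carrier (resolution R T 0)" using d[of f T 0] by simp
    have "restrict (augmentation R T) (carrier (resolution R T 0)) (differential R f) = \<zero>\<^bsub>T\<^esub>"
      by (rule image_le_kernel_gen[OF assms augmentation_linear[OF assms] _ f])
        (use formal_sum_closed[OF r] in auto)
    with c show "differential R f \<in> carrier (resolution R T 0) \<and> augmentation R T (differential R f) = \<zero>\<^bsub>T\<^esub>" by simp
  qed
  moreover have "?R \<subseteq> ?L"
    by clarify (rule kernel_le_image[OF r], auto)
  ultimately show ?thesis by blast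
qed

lemma exact_Suc:
  assumes "ring R"
  shows "differential R ` carrier (resolution R T (Suc (Suc n))) =
    {f \<in> carrier (resolution R T (Suc n)). differential R f = \<zero>\<^bsub>resolution R T n\<^esub>}" (is "?L = ?R")
proof -
  note r = assms
  note d = linear_mapsD(2)[OF differential_linear[OF r]]
  have z: "\<zero>\<^bsub>resolution R T n\<^esub> = (\<lambda>_. \<zero>\<^bsub>R\<^esub>)" by (simp add: free_module_def)
  have "?L \<subseteq> ?R"
  proof clarify
    fix f assume f: "f \<in> carrier (resolution R T (Suc (Suc n)))"
    then have c: "differential R f \<in> carrier (resolution R T (Suc n))" using d[of f T "Suc n"] by simp
    have "restrict (differential R) (carrier (resolution R T (Suc n))) (differential R f) = \<zero>\<^bsub>resolution R T n\<^esub>"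
      by (rule image_le_kernel_gen[OF left_module_free_module[OF assms] differential_linear[OF assms] _ f])
        (use formal_sum_closed[OF r] z in auto)
    with c show "differential R f \<in> carrier (resolution R T (Suc n)) \<and> differential R (differential R f) = \<zero>\<^bsub>resolution R T n\<^esub>" by simp
  qed
  moreover have "?R \<subseteq> ?L"
    by clarify (rule kernel_le_image[OF r], auto simp: z)
  ultimately show ?thesis by blast
qed


lemma linear_maps_eq_on_basis:
  assumes "left_module R M" "f \<in> linear_maps R (free_module R S) M" "g \<in> linear_maps R (free_module R S) M"
    "\<And>x. x \<in> S \<Longrightarrow> f (basis R x) = g (basis R x)" "v \<in> carrier (free_module R S)"
  shows "f v = g v"
proof -
  interpret M: left_module R M by fact
  note r = M.R.ring_axioms
  interpret F: left_module R "free_module R S" by (rule left_module_free_module) fact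
  obtain l where l: "set l \<subseteq> carrier R \<times> S" "formal_sum R l = v" using formal_sum_surj[OF r assms(5)] by blast
  have "f (formal_sum R l) = g (formal_sum R l)" using l(1)
  proof (induct l)
    case Nil
    have "f \<zero>\<^bsub>free_module R S\<^esub> = g \<zero>\<^bsub>free_module R S\<^esub>"
      using linear_maps_zero[OF F.left_module_axiom assms(1)] assms(2,3) by metis
    then show ?case by (simp add: free_module_def)
  next
    case (Cons p l)
    obtain a x where p: "p = (a, x)" by (cases p)
    have c: "a \<in> carrier R" "x \<in> S" "set l \<subseteq> carrier R \<times> S" using Cons.prems p by auto
    have b: "basis R x \<in> carrier (free_module R S)" "formal_sum R l \<in> carrier (free_module R S)"
      using basis_closed[OF r c(2)] formal_sum_closed[OF r c(3)] by auto
    show ?case unfolding p formal_sum_Cons[OF r c]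
      using b c assms(4) Cons.hyps
      by (simp add: linear_mapsD(3,4)[OF assms(2)] linear_mapsD(3,4)[OF assms(3)])
  qed
  then show ?thesis using l by simp
qed

lemma projective_lifting:
  fixes P :: "('r, 'p, 'x) module_scheme"
  assumes P: "projective R P" and A: "left_module R A" and C: "left_module R C"
    and g: "g \<in> linear_maps R A C" "g ` carrier A = carrier C" and f: "f \<in> linear_maps R P C"
  shows "\<exists>h \<in> linear_maps R P A. \<forall>x\<in>carrier P. g (h x) = f x"
proof -
  obtain S :: "'p set" and s p where P': "left_module R P" and s: "s \<in> linear_maps R P (free_module R S)"
    and p: "p \<in> linear_maps R (free_module R S) P" and ps: "\<And>x. x \<in> carrier P \<Longrightarrow> p (s x) = x"
    using P unfolding projective_def by blast
  interpret P: left_module R P by fact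
  note r = P.R.ring_axioms
  note F = left_module_free_module[OF r, of S]
  have fp: "compose (carrier (free_module R S)) f p \<in> linear_maps R (free_module R S) C"
    by (rule linear_maps_compose[OF p f F])
  have "\<exists>a\<in>carrier A. g a = f (p (basis R x))" if "x \<in> S" for x
  proof -
    have "f (p (basis R x)) \<in> carrier C"
      using linear_mapsD(2)[OF f] linear_mapsD(2)[OF p] basis_closed[OF r that] by auto
    then show ?thesis using g(2) by (metis imageE)
  qed
  then obtain k where k: "\<And>x. x \<in> S \<Longrightarrow> k x \<in> carrier A \<and> g (k x) = f (p (basis R x))" by metis
  then have kp: "k \<in> S \<rightarrow> carrier A" by auto
  define H where "H = restrict (linear_extension R A k) (carrier (free_module R S))"
  have H: "H \<in> linear_maps R (free_module R S) A" unfolding H_def by (rule linear_extension_linear[OF A kp])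
  have gH: "compose (carrier (free_module R S)) g H \<in> linear_maps R (free_module R S) C"
    by (rule linear_maps_compose[OF H g(1) F])
  have "compose (carrier (free_module R S)) g H v = compose (carrier (free_module R S)) f p v"
    if "v \<in> carrier (free_module R S)" for v
    by (rule linear_maps_eq_on_basis[OF C gH fp _ that])
      (use k linear_extension_basis[OF A kp] basis_closed[OF r] in \<open>auto simp: compose_def H_def\<close>)
  then have gf: "g (H v) = f (p v)" if "v \<in> carrier (free_module R S)" for v
    using that by (simp add: compose_def)
  show ?thesis
    by (rule bexI[OF _ linear_maps_compose[OF s H P']])
      (use gf linear_mapsD(2)[OF s] ps in \<open>auto simp: compose_def\<close>)
qed

lemma projective_if_lifting:
  fixes P :: "('r, 'p, 'x) module_scheme"
  assumes P: "left_module R P"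
    and lift: "\<And>(A :: ('r, 'p \<Rightarrow> 'r) module) g f.
      \<lbrakk>left_module R A; g \<in> linear_maps R A P; g ` carrier A = carrier P; f \<in> linear_maps R P P\<rbrakk>
      \<Longrightarrow> \<exists>h \<in> linear_maps R P A. \<forall>x\<in>carrier P. g (h x) = f x"
  shows "projective R P"
proof -
  interpret P: left_module R P by fact
  note r = P.R.ring_axioms
  let ?F = "free_module R (carrier P)"
  let ?g = "restrict (linear_extension R P (\<lambda>x. x)) (carrier ?F)"
  have i: "(\<lambda>x. x) \<in> carrier P \<rightarrow> carrier P" by auto
  have g: "?g \<in> linear_maps R ?F P" by (rule linear_extension_linear[OF P i])
  have "x \<in> ?g ` carrier ?F" if "x \<in> carrier P" for x
    by (rule image_eqI[OF _ basis_closed[OF r that]])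
      (simp add: linear_extension_basis[OF P i that] basis_closed[OF r that])
  then have "?g ` carrier ?F = carrier P" using linear_mapsD(2)[OF g] by blast
  moreover have "restrict (\<lambda>x. x) (carrier P) \<in> linear_maps R P P" by (rule linear_mapsI) auto
  ultimately obtain h where "h \<in> linear_maps R P ?F" "\<forall>x\<in>carrier P. ?g (h x) = x"
    using lift[OF left_module_free_module[OF r] g] by (metis (no_types, lifting) restrict_apply')
  then show ?thesis using g P unfolding projective_def by blast
qed

lemma quotient_module_facts:
  assumes "left_module R M" "submodule H R M"
  shows "left_module R (quotient_module M H)"
    and "(\<lambda>x\<in>carrier M. H +>\<^bsub>M\<^esub> x) \<in> linear_maps R M (quotient_module M H)"
    and "(\<lambda>x. H +>\<^bsub>M\<^esub> x) ` carrier M = carrier (quotient_module M H)"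
    and "{x \<in> carrier M. H +>\<^bsub>M\<^esub> x = \<zero>\<^bsub>quotient_module M H\<^esub>} = H"
proof -
  interpret left_module R M by fact
  interpret H: submodule H R M by fact
  interpret H: abelian_subgroup H M
    by (rule abelian_subgroupI3) (use H.subgroup_axioms M.abelian_group_axioms in \<open>auto simp: additive_subgroup_def\<close>)
  let ?Q = "quotient_module M H"
  have car: "carrier ?Q = (\<lambda>x. H +>\<^bsub>M\<^esub> x) ` carrier M"
    by (auto simp: quotient_module_def A_RCOSETS_def')
  have add: "(H +>\<^bsub>M\<^esub> x) \<oplus>\<^bsub>?Q\<^esub> (H +>\<^bsub>M\<^esub> y) = H +>\<^bsub>M\<^esub> (x \<oplus>\<^bsub>M\<^esub> y)"
    if "x \<in> carrier M" "y \<in> carrier M" for x y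
    using H.a_rcos_sum[OF that] by (simp add: quotient_module_def)
  have sm: "a \<odot>\<^bsub>?Q\<^esub> (H +>\<^bsub>M\<^esub> x) = H +>\<^bsub>M\<^esub> (a \<odot>\<^bsub>M\<^esub> x)"
    if "a \<in> carrier R" "x \<in> carrier M" for a x
  proof -
    have "H +>\<^bsub>M\<^esub> (a \<odot>\<^bsub>M\<^esub> y) = H +>\<^bsub>M\<^esub> (a \<odot>\<^bsub>M\<^esub> x)" if y: "y \<in> H +>\<^bsub>M\<^esub> x" for y
    proof -
      obtain h where h: "h \<in> H" "y = h \<oplus>\<^bsub>M\<^esub> x" using y by (auto simp: a_r_coset_def')
      then have hM: "h \<in> carrier M" using H.a_Hcarr by blast
      have ah: "a \<odot>\<^bsub>M\<^esub> h \<in> H" using H.smult_closed that \<open>a \<in> carrier R\<close> h by blast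
      have "a \<odot>\<^bsub>M\<^esub> y = a \<odot>\<^bsub>M\<^esub> h \<oplus>\<^bsub>M\<^esub> a \<odot>\<^bsub>M\<^esub> x"
        using h hM \<open>a \<in> carrier R\<close> \<open>x \<in> carrier M\<close> by (simp add: smult_r_distr)
      then have "a \<odot>\<^bsub>M\<^esub> y \<in> H +>\<^bsub>M\<^esub> (a \<odot>\<^bsub>M\<^esub> x)" using ah by (auto simp: a_r_coset_def')
      then show ?thesis
        using H.a_repr_independence'[of "a \<odot>\<^bsub>M\<^esub> y" "a \<odot>\<^bsub>M\<^esub> x"] \<open>a \<in> carrier R\<close> \<open>x \<in> carrier M\<close> by simp
    qed
    then have "(\<Union>y\<in>H +>\<^bsub>M\<^esub> x. H +>\<^bsub>M\<^esub> (a \<odot>\<^bsub>M\<^esub> y)) = (\<Union>y\<in>H +>\<^bsub>M\<^esub> x. H +>\<^bsub>M\<^esub> (a \<odot>\<^bsub>M\<^esub> x))"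
      by (rule SUP_cong[OF refl])
    moreover have "x \<in> H +>\<^bsub>M\<^esub> x" using H.a_rcos_self that by blast
    ultimately show ?thesis by (auto simp: quotient_module_def)
  qed
  have zero: "\<zero>\<^bsub>?Q\<^esub> = H +>\<^bsub>M\<^esub> \<zero>\<^bsub>M\<^esub>"
    using H.a_subset by (simp add: quotient_module_def)
  have rep: "\<exists>y\<in>carrier M. C = H +>\<^bsub>M\<^esub> y" if "C \<in> carrier ?Q" for C using that car by auto
  have mem: "H +>\<^bsub>M\<^esub> x \<in> carrier ?Q" if "x \<in> carrier M" for x using that car by auto
  show "left_module R ?Q"
  proof (rule left_moduleI)
    show "ring R" by (rule R.ring_axioms)
    show "\<zero>\<^bsub>?Q\<^esub> \<in> carrier ?Q" by (simp add: zero mem)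
    fix C assume "C \<in> carrier ?Q"
    then obtain x where x: "x \<in> carrier M" "C = H +>\<^bsub>M\<^esub> x" using rep by blast
    show "\<zero>\<^bsub>?Q\<^esub> \<oplus>\<^bsub>?Q\<^esub> C = C" using x(1) by (simp add: x(2) zero add)
    show "\<one>\<^bsub>R\<^esub> \<odot>\<^bsub>?Q\<^esub> C = C" using x(1) by (simp add: x(2) sm)
    show "\<exists>D\<in>carrier ?Q. D \<oplus>\<^bsub>?Q\<^esub> C = \<zero>\<^bsub>?Q\<^esub>"
      by (rule bexI[OF _ mem[of "\<ominus>\<^bsub>M\<^esub> x"]]) (use x(1) in \<open>simp_all add: x(2) add zero M.l_neg\<close>)
    fix a assume a: "a \<in> carrier R"
    show "a \<odot>\<^bsub>?Q\<^esub> C \<in> carrier ?Q" using x(1) a by (simp add: x(2) sm mem)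
    fix b assume b: "b \<in> carrier R"
    show "(a \<oplus>\<^bsub>R\<^esub> b) \<odot>\<^bsub>?Q\<^esub> C = a \<odot>\<^bsub>?Q\<^esub> C \<oplus>\<^bsub>?Q\<^esub> b \<odot>\<^bsub>?Q\<^esub> C"
      using x(1) a b by (simp add: x(2) sm add smult_l_distr)
    show "(a \<otimes>\<^bsub>R\<^esub> b) \<odot>\<^bsub>?Q\<^esub> C = a \<odot>\<^bsub>?Q\<^esub> (b \<odot>\<^bsub>?Q\<^esub> C)"
      using x(1) a b by (simp add: x(2) sm smult_assoc1)
  next
    fix C D assume "C \<in> carrier ?Q" "D \<in> carrier ?Q"
    then obtain x y where x: "x \<in> carrier M" "C = H +>\<^bsub>M\<^esub> x" and y: "y \<in> carrier M" "D = H +>\<^bsub>M\<^esub> y" using rep by blast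
    show "C \<oplus>\<^bsub>?Q\<^esub> D \<in> carrier ?Q" using x(1) y(1) by (simp add: x(2) y(2) add mem)
    show "C \<oplus>\<^bsub>?Q\<^esub> D = D \<oplus>\<^bsub>?Q\<^esub> C" using x(1) y(1) by (simp add: x(2) y(2) add M.a_comm)
    show "a \<odot>\<^bsub>?Q\<^esub> (C \<oplus>\<^bsub>?Q\<^esub> D) = a \<odot>\<^bsub>?Q\<^esub> C \<oplus>\<^bsub>?Q\<^esub> a \<odot>\<^bsub>?Q\<^esub> D" if "a \<in> carrier R" for a
      using x(1) y(1) that by (simp add: x(2) y(2) add sm smult_r_distr)
    fix E assume "E \<in> carrier ?Q"
    then obtain z where z: "z \<in> carrier M" "E = H +>\<^bsub>M\<^esub> z" using rep by blast
    show "C \<oplus>\<^bsub>?Q\<^esub> D \<oplus>\<^bsub>?Q\<^esub> E = C \<oplus>\<^bsub>?Q\<^esub> (D \<oplus>\<^bsub>?Q\<^esub> E)"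
      using x(1) y(1) z(1) by (simp add: x(2) y(2) z(2) add M.a_assoc)
  qed
  show "(\<lambda>x\<in>carrier M. H +>\<^bsub>M\<^esub> x) \<in> linear_maps R M ?Q"
    by (rule linear_mapsI) (simp_all add: mem add sm)
  show "(\<lambda>x. H +>\<^bsub>M\<^esub> x) ` carrier M = carrier ?Q" by (simp add: car)
  have z: "\<zero>\<^bsub>?Q\<^esub> = H" by (simp add: quotient_module_def)
  show "{x \<in> carrier M. H +>\<^bsub>M\<^esub> x = \<zero>\<^bsub>?Q\<^esub>} = H"
  proof (intro equalityI subsetI)
    fix x assume "x \<in> {x \<in> carrier M. H +>\<^bsub>M\<^esub> x = \<zero>\<^bsub>?Q\<^esub>}"
    then have "x \<in> carrier M" "H +>\<^bsub>M\<^esub> x = H" using z by simp_all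
    then show "x \<in> H" using H.a_rcos_self by metis
  next
    fix x assume x: "x \<in> H"
    show "x \<in> {x \<in> carrier M. H +>\<^bsub>M\<^esub> x = \<zero>\<^bsub>?Q\<^esub>}"
      using H.a_Hcarr[OF x] H.a_rcos_const[OF x] z by simp
  qed
qed

lemma comm_group_hom_group:
  assumes "left_module R M" "left_module R N"
    "\<And>a x. \<lbrakk>a \<in> carrier R; x \<in> carrier M\<rbrakk> \<Longrightarrow> a \<odot>\<^bsub>M\<^esub> x \<in> carrier M"
  shows "comm_group (hom_group R M N)"
proof -
  interpret M: left_module R M by fact
  interpret N: left_module R N by fact
  let ?G = "hom_group R M N"
  have car: "carrier ?G = linear_maps R M N" by (simp add: hom_group_def)
  have ml: "f \<otimes>\<^bsub>?G\<^esub> g = (\<lambda>x\<in>carrier M. f x \<oplus>\<^bsub>N\<^esub> g x)" for f g by (simp add: hom_group_def)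
  have on: "\<one>\<^bsub>?G\<^esub> = (\<lambda>x\<in>carrier M. \<zero>\<^bsub>N\<^esub>)" by (simp add: hom_group_def)
  note D = linear_mapsD
  show ?thesis
  proof (rule comm_groupI)
    fix f g assume f: "f \<in> carrier ?G" and g: "g \<in> carrier ?G"
    note f' = f[unfolded car] and g' = g[unfolded car]
    show "f \<otimes>\<^bsub>?G\<^esub> g \<in> carrier ?G" unfolding car ml
      by (rule linear_mapsI) (auto simp: D[OF f'] D[OF g'] N.M.a_ac N.smult_r_distr)
    show "f \<otimes>\<^bsub>?G\<^esub> g = g \<otimes>\<^bsub>?G\<^esub> f" unfolding ml
      by (rule restrict_ext) (auto simp: D[OF f'] D[OF g'] N.M.a_comm)
    fix h assume h: "h \<in> carrier ?G"
    note h' = h[unfolded car]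
    show "f \<otimes>\<^bsub>?G\<^esub> g \<otimes>\<^bsub>?G\<^esub> h = f \<otimes>\<^bsub>?G\<^esub> (g \<otimes>\<^bsub>?G\<^esub> h)" unfolding ml
      by (rule restrict_ext) (auto simp: D[OF f'] D[OF g'] D[OF h'] N.M.a_assoc)
  next
    show "\<one>\<^bsub>?G\<^esub> \<in> carrier ?G" unfolding car on by (rule linear_mapsI) auto
  next
    fix f assume f: "f \<in> carrier ?G"
    note f' = f[unfolded car]
    show "\<one>\<^bsub>?G\<^esub> \<otimes>\<^bsub>?G\<^esub> f = f" unfolding ml on
      by (rule extensionalityI[OF restrict_extensional D(1)[OF f']]) (auto simp: D[OF f'])
    let ?g = "\<lambda>x\<in>carrier M. \<ominus>\<^bsub>N\<^esub> f x"
    have neg: "\<ominus>\<^bsub>N\<^esub> (a \<odot>\<^bsub>N\<^esub> x) = a \<odot>\<^bsub>N\<^esub> (\<ominus>\<^bsub>N\<^esub> x)" if "a \<in> carrier R" "x \<in> carrier N" for a x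
    proof -
      have "a \<odot>\<^bsub>N\<^esub> (\<ominus>\<^bsub>N\<^esub> x) \<oplus>\<^bsub>N\<^esub> a \<odot>\<^bsub>N\<^esub> x = \<zero>\<^bsub>N\<^esub>"
        using that by (simp add: N.smult_r_distr[symmetric] N.M.l_neg)
      then show ?thesis using that by (metis N.M.a_inv_closed N.M.minus_equality N.smult_closed)
    qed
    have "?g \<in> carrier ?G" unfolding car
      by (rule linear_mapsI) (auto simp: D[OF f'] N.M.minus_add neg)
    moreover have "?g \<otimes>\<^bsub>?G\<^esub> f = \<one>\<^bsub>?G\<^esub>" unfolding ml on
      by (rule restrict_ext) (auto simp: D[OF f'] N.M.l_neg)
    ultimately show "\<exists>g\<in>carrier ?G. g \<otimes>\<^bsub>?G\<^esub> f = \<one>\<^bsub>?G\<^esub>" by blast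
  qed
qed

lemma codifferential_hom:
  fixes N :: "('r, 'n, 'y) module_scheme"
  assumes "left_module R T" "left_module R N"
  shows "codifferential R T n \<in> hom (hom_group R (resolution R T n) N) (hom_group R (resolution R T (Suc n)) N)"
proof -
  interpret N: left_module R N by fact
  note r = N.R.ring_axioms
  note F = left_module_free_module[OF r]
  note dl = differential_linear[OF r, of T n]
  note dc = linear_mapsD(2)[OF dl]
  have e: "codifferential R T n f = compose (carrier (resolution R T (Suc n))) f (restrict (differential R) (carrier (resolution R T (Suc n))))" for f :: "_ \<Rightarrow> 'n"
    by (auto simp: codifferential_def compose_def)
  have c: "codifferential R T n f \<in> linear_maps R (resolution R T (Suc n)) N"
    if "f \<in> linear_maps R (resolution R T n) N" for f
    unfolding e by (rule linear_maps_compose[OF dl that F])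
  have dc': "differential R x \<in> carrier (resolution R T n)" if "x \<in> carrier (resolution R T (Suc n))" for x
    using dc[OF that] that by simp
  show ?thesis
    by (rule homI) (use c in \<open>auto simp: hom_group_def codifferential_def compose_def dc' intro!: restrict_ext\<close>)
qed

lemma codifferential_codifferential:
  assumes "left_module R T" "left_module R N" "f \<in> linear_maps R (resolution R T n) N"
  shows "codifferential R T (Suc n) (codifferential R T n f) = \<one>\<^bsub>hom_group R (resolution R T (Suc (Suc n))) N\<^esub>"
proof -
  interpret N: left_module R N by fact
  note r = N.R.ring_axioms
  note F = left_module_free_module[OF r]
  have 1: "differential R x \<in> carrier (resolution R T (Suc n)) \<and> differential R (differential R x) = \<zero>\<^bsub>resolution R T n\<^esub>"
    if "x \<in> carrier (resolution R T (Suc (Suc n)))" for x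
    using exact_Suc[OF r, of T n] that by blast
  show ?thesis
    using 1 linear_maps_zero[OF F assms(2,3)]
    by (auto simp: codifferential_def compose_def hom_group_def intro!: restrict_ext)
qed

lemma Ext_comm_group:
  assumes "left_module R T" "left_module R N"
  shows "comm_group (Ext R n T N)"
proof -
  interpret N: left_module R N by fact
  note r = N.R.ring_axioms
  note F = left_module_free_module[OF r]
  let ?H = "\<lambda>n. hom_group R (resolution R T n) N"
  have G: "comm_group (?H n)" for n by (rule comm_group_hom_group[OF F assms(2)]) (use left_module.smult_closed[OF F] in auto)
  interpret G: comm_group "?H i" for i by (rule G)
  have gh: "group_hom (?H n) (?H (Suc n)) (codifferential R T n)" for n
    by (intro group_hom.intro group_hom_axioms.intro codifferential_hom assms G.is_group)
  have Z: "subgroup (cocycles R n T N) (?H n)"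
    unfolding cocycles_def by (rule group_hom.subgroup_kernel[OF gh])
  have B: "subgroup (coboundaries R n T N) (?H n)"
    using G.triv_subgroup[of 0] group_hom.img_is_subgroup[OF gh]
    by (cases n) (simp_all add: coboundaries_def del: generators.simps)
  have "coboundaries R n T N \<subseteq> cocycles R n T N"
  proof (cases n)
    case 0
    then show ?thesis using subgroup.one_closed[OF Z] by (auto simp: coboundaries_def)
  next
    case (Suc m)
    have "codifferential R T m f \<in> carrier (?H (Suc m))" if "f \<in> carrier (?H m)" for f
      using group_hom.hom_closed[OF gh that] .
    then show ?thesis
      using Suc codifferential_codifferential[OF assms, of _ m]
      by (auto simp: coboundaries_def cocycles_def kernel_def hom_group_def)
  qed
  then have 1: "subgroup (coboundaries R n T N) ((?H n)\<lparr>carrier := cocycles R n T N\<rparr>)"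
    by (rule G.subgroup_incl[OF B Z])
  have 2: "comm_group ((?H n)\<lparr>carrier := cocycles R n T N\<rparr>)"
    by (rule group.group_comm_groupI[OF G.subgroup_imp_group[OF Z]])
      (use G.m_comm subgroup.mem_carrier[OF Z] in simp)
  show ?thesis unfolding Ext_def by (rule comm_group.abelian_FactGroup[OF 2 1])
qed

end

theory Submission
  imports Defs
begin

text \<open>Let \<open>A = ker \<pi>\<close> and \<open>T = P/(A + B)\<close>. Since \<open>P\<close> has a finite dual basis and \<open>Ext\<^sup>1(T, R) = 0\<close>, the
  projection \<open>A \<oplus> B \<rightarrow> A \<subseteq> P\<close> extends to an endomorphism \<open>E\<close> of \<open>P\<close>. The map \<open>\<pi> \<circ> E\<close> vanishes on
  \<open>A + B\<close>, so its composite with any \<open>M \<rightarrow> R\<close> factors through \<open>T\<close> and is zero because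
  \<open>Hom(T, R) = 0\<close>; as \<open>M\<close> is torsionless, \<open>\<pi> \<circ> E = 0\<close>. Hence \<open>E\<close> is a retraction of \<open>P\<close> onto \<open>A\<close>,
  and \<open>id - E\<close> induces a section of \<open>\<pi>\<close>.\<close>

section \<open>Linear maps given by relations, and submodules\<close>

lemma (in left_module) smult_minus_one:
  assumes "x \<in> carrier M"
  shows "(\<ominus> \<one>) \<odot>\<^bsub>M\<^esub> x = \<ominus>\<^bsub>M\<^esub> x"
proof -
  have "(\<ominus> \<one> \<oplus> \<one>) \<odot>\<^bsub>M\<^esub> x = (\<ominus> \<one>) \<odot>\<^bsub>M\<^esub> x \<oplus>\<^bsub>M\<^esub> x"
    using assms by (subst smult_l_distr) auto
  then show ?thesis
    using assms by (intro M.minus_equality[symmetric]) (auto simp: R.l_neg)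
qed

text \<open>If \<open>x\<close> is related to \<open>y\<close> and to \<open>y'\<close>, then zero
  is related to \<open>y - y'\<close>, so the condition at zero makes \<open>Q\<close>
  single-valued. Being total as well, \<open>Q\<close> is the graph of a map, and its closure
  properties make this map linear. All maps below that need a proof of well-definedness are built in
  this way.\<close>

lemma linear_map_of_relation:
  assumes X: "left_module R X" and N: "left_module R N"
    and total: "\<And>x. x \<in> carrier X \<Longrightarrow> \<exists>y\<in>carrier N. Q x y"
    and add: "\<And>x x' y y'. \<lbrakk>x \<in> carrier X; x' \<in> carrier X; y \<in> carrier N; y' \<in> carrier N; Q x y; Q x' y'\<rbrakk>
      \<Longrightarrow> Q (x \<oplus>\<^bsub>X\<^esub> x') (y \<oplus>\<^bsub>N\<^esub> y')"
    and smult: "\<And>a x y. \<lbrakk>a \<in> carrier R; x \<in> carrier X; y \<in> carrier N; Q x y\<rbrakk>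
      \<Longrightarrow> Q (a \<odot>\<^bsub>X\<^esub> x) (a \<odot>\<^bsub>N\<^esub> y)"
    and zero: "\<And>y. \<lbrakk>y \<in> carrier N; Q \<zero>\<^bsub>X\<^esub> y\<rbrakk> \<Longrightarrow> y = \<zero>\<^bsub>N\<^esub>"
  shows "\<exists>f \<in> linear_maps R X N. \<forall>x\<in>carrier X. Q x (f x)"
proof -
  interpret X: left_module R X by fact
  interpret N: left_module R N by fact
  have uniq: "y = y'" if "x \<in> carrier X" "y \<in> carrier N" "y' \<in> carrier N" "Q x y" "Q x y'" for x y y'
  proof -
    \<comment> \<open>Closure of \<open>Q\<close> under differences is obtained from the scalar
      \<open>-1\<close>, as the assumptions speak only of sums and scalar multiples.\<close>
    let ?m = "\<ominus>\<^bsub>R\<^esub> \<one>\<^bsub>R\<^esub>"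
    have "Q (?m \<odot>\<^bsub>X\<^esub> x) (?m \<odot>\<^bsub>N\<^esub> y')" using that by (intro smult) auto
    then have "Q (x \<oplus>\<^bsub>X\<^esub> ?m \<odot>\<^bsub>X\<^esub> x) (y \<oplus>\<^bsub>N\<^esub> ?m \<odot>\<^bsub>N\<^esub> y')" using that by (intro add) auto
    then have "y \<oplus>\<^bsub>N\<^esub> \<ominus>\<^bsub>N\<^esub> y' = \<zero>\<^bsub>N\<^esub>"
      using that by (intro zero) (auto simp: X.smult_minus_one N.smult_minus_one X.M.r_neg)
    then show ?thesis using that by (metis N.M.add.inv_equality N.M.add.inv_inv N.M.a_inv_closed)
  qed
  obtain f where f: "\<And>x. x \<in> carrier X \<Longrightarrow> f x \<in> carrier N \<and> Q x (f x)" using total by metis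
  have "restrict f (carrier X) \<in> linear_maps R X N"
  proof (rule linear_mapsI)
    fix x y assume c: "x \<in> carrier X" "y \<in> carrier X"
    then have "f (x \<oplus>\<^bsub>X\<^esub> y) = f x \<oplus>\<^bsub>N\<^esub> f y"
      using f add by (intro uniq[of "x \<oplus>\<^bsub>X\<^esub> y"]) auto
    then show "restrict f (carrier X) (x \<oplus>\<^bsub>X\<^esub> y) = restrict f (carrier X) x \<oplus>\<^bsub>N\<^esub> restrict f (carrier X) y"
      using c by simp
  next
    fix a x assume c: "a \<in> carrier R" "x \<in> carrier X"
    then have "f (a \<odot>\<^bsub>X\<^esub> x) = a \<odot>\<^bsub>N\<^esub> f x"
      using f smult by (intro uniq[of "a \<odot>\<^bsub>X\<^esub> x"]) auto
    then show "restrict f (carrier X) (a \<odot>\<^bsub>X\<^esub> x) = a \<odot>\<^bsub>N\<^esub> restrict f (carrier X) x"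
      using c by simp
  qed (use f in auto)
  then show ?thesis using f by (intro bexI) auto
qed

text \<open>The pairs \<open>(p x, f x)\<close> form a relation that is total because
  \<open>p\<close> is onto and relates zero only to zero because \<open>f\<close> vanishes on the
  kernel of \<open>p\<close>.\<close>

lemma linear_map_factor:
  assumes X: "left_module R X" and Y: "left_module R Y" and N: "left_module R N"
    and p: "p \<in> linear_maps R X Y" "p ` carrier X = carrier Y"
    and f: "f \<in> linear_maps R X N"
    and ker: "\<And>x. \<lbrakk>x \<in> carrier X; p x = \<zero>\<^bsub>Y\<^esub>\<rbrakk> \<Longrightarrow> f x = \<zero>\<^bsub>N\<^esub>"
  shows "\<exists>g \<in> linear_maps R Y N. \<forall>x\<in>carrier X. g (p x) = f x"
proof -
  interpret X: left_module R X by fact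
  interpret Y: left_module R Y by fact
  interpret N: left_module R N by fact
  note p' = linear_mapsD[OF p(1)] and f' = linear_mapsD[OF f]
  let ?Q = "\<lambda>t y. \<exists>x\<in>carrier X. t = p x \<and> y = f x"
  have "\<exists>g \<in> linear_maps R Y N. \<forall>t\<in>carrier Y. ?Q t (g t)"
  proof (rule linear_map_of_relation[OF Y N])
    fix t assume "t \<in> carrier Y"
    then show "\<exists>y\<in>carrier N. ?Q t y" unfolding p(2)[symmetric] using f'(2) by blast
  next
    fix t t' y y' assume "?Q t y" "?Q t' y'"
    then show "?Q (t \<oplus>\<^bsub>Y\<^esub> t') (y \<oplus>\<^bsub>N\<^esub> y')" using p'(3) f'(3) by (metis X.M.a_closed)
  next
    fix a t y assume "a \<in> carrier R" "?Q t y"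
    then show "?Q (a \<odot>\<^bsub>Y\<^esub> t) (a \<odot>\<^bsub>N\<^esub> y)" using p'(4) f'(4) by (metis X.smult_closed)
  next
    fix y assume "?Q \<zero>\<^bsub>Y\<^esub> y"
    then show "y = \<zero>\<^bsub>N\<^esub>" using ker by auto
  qed
  then obtain g where g: "g \<in> linear_maps R Y N" "\<And>t. t \<in> carrier Y \<Longrightarrow> ?Q t (g t)" by blast
  have "g (p x) = f x" if x: "x \<in> carrier X" for x
  proof -
    \<comment> \<open>The relation yields only some \<open>x'\<close> in the fibre of
      \<open>x\<close>; the kernel condition applied to \<open>x - x'\<close> replaces it by
      \<open>x\<close> itself.\<close>
    obtain x' where x': "x' \<in> carrier X" "p x = p x'" "g (p x) = f x'" using g(2)[OF p'(2)[OF x]] by blast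
    let ?d = "x \<oplus>\<^bsub>X\<^esub> (\<ominus>\<^bsub>R\<^esub> \<one>\<^bsub>R\<^esub>) \<odot>\<^bsub>X\<^esub> x'"
    have "p ?d = \<zero>\<^bsub>Y\<^esub>" using x x'(1,2) p'(2) by (simp add: p'(3,4) Y.smult_minus_one Y.M.r_neg)
    then have "f ?d = \<zero>\<^bsub>N\<^esub>" using x x' by (intro ker) auto
    then have "f x \<oplus>\<^bsub>N\<^esub> \<ominus>\<^bsub>N\<^esub> f x' = \<zero>\<^bsub>N\<^esub>" using x x'(1) f'(2) by (simp add: f'(3,4) N.smult_minus_one)
    then show ?thesis using x x' f'(2) by (metis N.M.add.inv_equality N.M.add.inv_inv N.M.a_inv_closed)
  qed
  then show ?thesis using g(1) by blast
qed

lemma submodule_left_module: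
  assumes "left_module R M" "submodule H R M"
  shows "left_module R (M\<lparr>carrier := H\<rparr>)"
proof -
  interpret left_module R M by fact
  interpret H: submodule H R M by fact
  have s: "x \<in> carrier M" if "x \<in> H" for x using H.mem_carrier that by simp
  have i: "\<exists>y\<in>H. y \<oplus>\<^bsub>M\<^esub> x = \<zero>\<^bsub>M\<^esub>" if "x \<in> H" for x
    using H.m_inv_closed[OF that] M.l_neg[OF s[OF that]] by (auto simp: a_inv_def)
  show ?thesis
  proof (rule left_moduleI)
    show "\<exists>y\<in>carrier (M\<lparr>carrier := H\<rparr>). y \<oplus>\<^bsub>M\<lparr>carrier := H\<rparr>\<^esub> x = \<zero>\<^bsub>M\<lparr>carrier := H\<rparr>\<^esub>"
      if "x \<in> carrier (M\<lparr>carrier := H\<rparr>)" for x using i that by simp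
    show "x \<oplus>\<^bsub>M\<lparr>carrier := H\<rparr>\<^esub> y = y \<oplus>\<^bsub>M\<lparr>carrier := H\<rparr>\<^esub> x"
      if "x \<in> carrier (M\<lparr>carrier := H\<rparr>)" "y \<in> carrier (M\<lparr>carrier := H\<rparr>)" for x y
      using M.a_comm s that by simp
  qed (use H.m_closed H.one_closed in
      \<open>simp_all add: R.ring_axioms s M.a_assoc smult_l_distr smult_r_distr smult_assoc1\<close>)
qed

text \<open>Closure under negation comes from multiplication by the scalar
  \<open>-1\<close>.\<close>

lemma submoduleI_left:
  assumes "left_module R M" "H \<subseteq> carrier M" "\<zero>\<^bsub>M\<^esub> \<in> H"
    and "\<And>x y. \<lbrakk>x \<in> H; y \<in> H\<rbrakk> \<Longrightarrow> x \<oplus>\<^bsub>M\<^esub> y \<in> H"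
    and "\<And>a x. \<lbrakk>a \<in> carrier R; x \<in> H\<rbrakk> \<Longrightarrow> a \<odot>\<^bsub>M\<^esub> x \<in> H"
  shows "submodule H R M"
proof -
  interpret left_module R M by fact
  have "\<ominus>\<^bsub>M\<^esub> x \<in> H" if "x \<in> H" for x
    using assms(5)[of "\<ominus>\<^bsub>R\<^esub> \<one>\<^bsub>R\<^esub>" x] smult_minus_one[of x] that assms(2) by auto
  then show ?thesis using assms
    by (auto intro!: submodule.intro submodule_axioms.intro M.add.subgroupI simp: a_inv_def[symmetric])
qed

text \<open>Restates the closure rules of \<open>submodule\<close>, which come from a subgroup
  written multiplicatively, in the additive notation of \<open>M\<close>.\<close>

lemma submodule_closed:
  assumes "submodule H R M"
  shows "\<And>x. x \<in> H \<Longrightarrow> x \<in> carrier M" "\<zero>\<^bsub>M\<^esub> \<in> H"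
    "\<And>x y. \<lbrakk>x \<in> H; y \<in> H\<rbrakk> \<Longrightarrow> x \<oplus>\<^bsub>M\<^esub> y \<in> H"
    "\<And>a x. \<lbrakk>a \<in> carrier R; x \<in> H\<rbrakk> \<Longrightarrow> a \<odot>\<^bsub>M\<^esub> x \<in> H"
    "\<And>x. x \<in> H \<Longrightarrow> \<ominus>\<^bsub>M\<^esub> x \<in> H"
proof -
  interpret submodule H R M by fact
  show "\<And>x. x \<in> H \<Longrightarrow> x \<in> carrier M" using mem_carrier by simp
  show "\<zero>\<^bsub>M\<^esub> \<in> H" using one_closed by simp
  show "\<And>x y. \<lbrakk>x \<in> H; y \<in> H\<rbrakk> \<Longrightarrow> x \<oplus>\<^bsub>M\<^esub> y \<in> H" using m_closed by simp
  show "\<And>a x. \<lbrakk>a \<in> carrier R; x \<in> H\<rbrakk> \<Longrightarrow> a \<odot>\<^bsub>M\<^esub> x \<in> H" by (rule smult_closed)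
  show "\<And>x. x \<in> H \<Longrightarrow> \<ominus>\<^bsub>M\<^esub> x \<in> H" using m_inv_closed by (simp add: a_inv_def)
qed

lemma submodule_kernel:
  assumes "left_module R M" "left_module R N" "f \<in> linear_maps R M N"
  shows "submodule (a_kernel M N f) R M"
proof -
  interpret M: left_module R M by fact
  interpret N: left_module R N by fact
  show ?thesis
    by (rule submoduleI_left[OF assms(1)])
      (auto simp: a_kernel_def' linear_maps_zero[OF assms] linear_mapsD[OF assms(3)])
qed

lemma submodule_set_add:
  assumes "left_module R M" "submodule H R M" "submodule K R M"
  shows "submodule (H <+>\<^bsub>M\<^esub> K) R M"
proof -
  interpret left_module R M by fact
  note H = submodule_closed[OF assms(2)] and K = submodule_closed[OF assms(3)]
  have mem: "x \<in> H <+>\<^bsub>M\<^esub> K \<longleftrightarrow> (\<exists>h\<in>H. \<exists>k\<in>K. x = h \<oplus>\<^bsub>M\<^esub> k)" for x by (auto simp: set_add_def')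
  show ?thesis
  proof (rule submoduleI_left[OF assms(1)])
    show "H <+>\<^bsub>M\<^esub> K \<subseteq> carrier M" using H(1) K(1) by (auto simp: mem)
    show "\<zero>\<^bsub>M\<^esub> \<in> H <+>\<^bsub>M\<^esub> K" unfolding mem using H(2) K(2) by (metis M.r_zero M.zero_closed)
    fix x assume "x \<in> H <+>\<^bsub>M\<^esub> K"
    then obtain h k where x: "h \<in> H" "k \<in> K" "x = h \<oplus>\<^bsub>M\<^esub> k" by (auto simp: mem)
    show "a \<odot>\<^bsub>M\<^esub> x \<in> H <+>\<^bsub>M\<^esub> K" if "a \<in> carrier R" for a
      unfolding mem using x H K that by (metis smult_r_distr)
    fix y assume "y \<in> H <+>\<^bsub>M\<^esub> K"
    then obtain h' k' where y: "h' \<in> H" "k' \<in> K" "y = h' \<oplus>\<^bsub>M\<^esub> k'" by (auto simp: mem)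
    have "x \<oplus>\<^bsub>M\<^esub> y = (h \<oplus>\<^bsub>M\<^esub> h') \<oplus>\<^bsub>M\<^esub> (k \<oplus>\<^bsub>M\<^esub> k')"
      using x y H(1) K(1) by (simp add: M.a_ac)
    then show "x \<oplus>\<^bsub>M\<^esub> y \<in> H <+>\<^bsub>M\<^esub> K" unfolding mem using x y H(3) K(3) by blast
  qed
qed

text \<open>An equation \<open>y + z = y' + z'\<close> with \<open>y\<close>, \<open>y'\<close> in
  \<open>H\<close> and \<open>z\<close>, \<open>z'\<close> in \<open>K\<close> puts
  \<open>y - y' = z' - z\<close> into the intersection, so the \<open>H\<close>-component of an
  element of \<open>H + K\<close> is unique. Hence the relation \<open>?Q\<close>, congruence modulo
  \<open>K\<close>, is the graph of the projection.\<close>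

lemma projection_of_trivial_intersection:
  assumes M: "left_module R M" and H: "submodule H R M" and K: "submodule K R M"
    and HK: "H \<inter> K = {\<zero>\<^bsub>M\<^esub>}"
  shows "\<exists>e \<in> linear_maps R (M\<lparr>carrier := H <+>\<^bsub>M\<^esub> K\<rparr>) (M\<lparr>carrier := H\<rparr>).
    (\<forall>x\<in>H. e x = x) \<and> (\<forall>x\<in>K. e x = \<zero>\<^bsub>M\<^esub>)"
proof -
  interpret left_module R M by fact
  note h = submodule_closed[OF H] and k = submodule_closed[OF K]
  let ?S = "M\<lparr>carrier := H <+>\<^bsub>M\<^esub> K\<rparr>" and ?Q = "\<lambda>x y. \<exists>z\<in>K. x = y \<oplus>\<^bsub>M\<^esub> z"
  have mem: "x \<in> H <+>\<^bsub>M\<^esub> K \<longleftrightarrow> (\<exists>h\<in>H. \<exists>k\<in>K. x = h \<oplus>\<^bsub>M\<^esub> k)" for x by (auto simp: set_add_def')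
  have uniq: "y = y'" if "y \<in> H" "z \<in> K" "y' \<in> H" "z' \<in> K" "y \<oplus>\<^bsub>M\<^esub> z = y' \<oplus>\<^bsub>M\<^esub> z'" for y z y' z'
  proof -
    have c: "y \<in> carrier M" "z \<in> carrier M" "y' \<in> carrier M" "z' \<in> carrier M" using that h(1) k(1) by auto
    have "y \<oplus>\<^bsub>M\<^esub> \<ominus>\<^bsub>M\<^esub> y' = (y \<oplus>\<^bsub>M\<^esub> z) \<oplus>\<^bsub>M\<^esub> (\<ominus>\<^bsub>M\<^esub> z \<oplus>\<^bsub>M\<^esub> \<ominus>\<^bsub>M\<^esub> y')"
      using c by (simp add: M.a_assoc M.r_neg2)
    also have "\<dots> = (z' \<oplus>\<^bsub>M\<^esub> y') \<oplus>\<^bsub>M\<^esub> (\<ominus>\<^bsub>M\<^esub> y' \<oplus>\<^bsub>M\<^esub> \<ominus>\<^bsub>M\<^esub> z)"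
      unfolding that(5) using c by (metis M.a_comm M.a_inv_closed)
    also have "\<dots> = z' \<oplus>\<^bsub>M\<^esub> \<ominus>\<^bsub>M\<^esub> z"
      using c by (simp add: M.a_assoc M.r_neg2)
    finally have "y \<oplus>\<^bsub>M\<^esub> \<ominus>\<^bsub>M\<^esub> y' = z' \<oplus>\<^bsub>M\<^esub> \<ominus>\<^bsub>M\<^esub> z" .
    then have "y \<oplus>\<^bsub>M\<^esub> \<ominus>\<^bsub>M\<^esub> y' \<in> H \<inter> K" using that h(3,5) k(3,5) by (metis IntI)
    then have "y \<oplus>\<^bsub>M\<^esub> \<ominus>\<^bsub>M\<^esub> y' = \<zero>\<^bsub>M\<^esub>" using HK by simp
    then show ?thesis using c by (metis M.add.inv_equality M.add.inv_inv M.a_inv_closed)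
  qed
  have "\<exists>e \<in> linear_maps R ?S (M\<lparr>carrier := H\<rparr>). \<forall>x\<in>carrier ?S. ?Q x (e x)"
  proof (rule linear_map_of_relation[OF submodule_left_module[OF M submodule_set_add[OF M H K]] submodule_left_module[OF M H]])
    fix x assume "x \<in> carrier ?S"
    then show "\<exists>y\<in>carrier (M\<lparr>carrier := H\<rparr>). ?Q x y" by (auto simp: mem)
  next
    fix x x' y y' assume "y \<in> carrier (M\<lparr>carrier := H\<rparr>)" "y' \<in> carrier (M\<lparr>carrier := H\<rparr>)" "?Q x y" "?Q x' y'"
    then obtain z z' where z: "y \<in> H" "y' \<in> H" "z \<in> K" "z' \<in> K" "x = y \<oplus>\<^bsub>M\<^esub> z" "x' = y' \<oplus>\<^bsub>M\<^esub> z'" by auto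
    then have "x \<oplus>\<^bsub>M\<^esub> x' = (y \<oplus>\<^bsub>M\<^esub> y') \<oplus>\<^bsub>M\<^esub> (z \<oplus>\<^bsub>M\<^esub> z')" using h(1) k(1) by (simp add: M.a_ac)
    then show "?Q (x \<oplus>\<^bsub>?S\<^esub> x') (y \<oplus>\<^bsub>M\<lparr>carrier := H\<rparr>\<^esub> y')" using z k(3) by auto
  next
    fix a x y assume "a \<in> carrier R" "y \<in> carrier (M\<lparr>carrier := H\<rparr>)" "?Q x y"
    then show "?Q (a \<odot>\<^bsub>?S\<^esub> x) (a \<odot>\<^bsub>M\<lparr>carrier := H\<rparr>\<^esub> y)" using h(1) k(1,4) by (auto simp: smult_r_distr)
  next
    fix y assume "y \<in> carrier (M\<lparr>carrier := H\<rparr>)" "?Q \<zero>\<^bsub>?S\<^esub> y"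
    then obtain z where z: "y \<in> H" "z \<in> K" "y \<oplus>\<^bsub>M\<^esub> z = \<zero>\<^bsub>M\<^esub>" by auto
    have "y = \<zero>\<^bsub>M\<^esub>" by (rule uniq[of _ z _ "\<zero>\<^bsub>M\<^esub>"]) (use z h k in auto)
    then show "y = \<zero>\<^bsub>M\<lparr>carrier := H\<rparr>\<^esub>" by simp
  qed
  then obtain e where e: "e \<in> linear_maps R ?S (M\<lparr>carrier := H\<rparr>)" "\<And>x. x \<in> H <+>\<^bsub>M\<^esub> K \<Longrightarrow> ?Q x (e x)"
    by auto
  have eH: "e x \<in> H" if "x \<in> H <+>\<^bsub>M\<^esub> K" for x using linear_mapsD(2)[OF e(1), of x] that by simp
  have 1: "e x = x" if "x \<in> H" for x
  proof -
    have x: "x = x \<oplus>\<^bsub>M\<^esub> \<zero>\<^bsub>M\<^esub>" using that h(1) by simp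
    then have "x \<in> H <+>\<^bsub>M\<^esub> K" using that k(2) unfolding mem by blast
    then show ?thesis using uniq[OF eH _ that k(2)] e(2) x by metis
  qed
  have 2: "e x = \<zero>\<^bsub>M\<^esub>" if "x \<in> K" for x
  proof -
    have x: "x = \<zero>\<^bsub>M\<^esub> \<oplus>\<^bsub>M\<^esub> x" using that k(1) by simp
    then have "x \<in> H <+>\<^bsub>M\<^esub> K" using that h(2) unfolding mem by blast
    then show ?thesis using uniq[OF eH _ h(2) that] e(2) x by metis
  qed
  show ?thesis using e(1) 1 2 by blast
qed

section \<open>Consequences of the vanishing of Ext in degrees 0 and 1\<close>

declare generators.simps [simp del]

text \<open>The only element of a trivial quotient is the coset of the unit, which is the group of
  coboundaries itself. So the coset of \<open>f\<close> is this group, and it contains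
  \<open>f\<close> because the unit is a coboundary.\<close>

lemma trivial_Ext_cocycle:
  assumes T: "left_module R T" and N: "left_module R N" and triv: "trivial_group (Ext R n T N)"
    and f: "f \<in> cocycles R n T N"
  shows "f \<in> coboundaries R n T N"
proof -
  let ?H = "hom_group R (resolution R T n) N"
  interpret N: left_module R N by fact
  note F = left_module_free_module[OF N.R.ring_axioms, of "generators R T n"]
  interpret G: comm_group ?H
    by (rule comm_group_hom_group[OF F N left_module.smult_closed[OF F]])
  have fG: "f \<in> carrier ?H" using f by (simp add: cocycles_def kernel_def)
  \<comment> \<open>In positive degree the unit is the image of the zero map, because the
    codifferential is a homomorphism.\<close>
  have one: "\<one>\<^bsub>?H\<^esub> \<in> coboundaries R n T N"
  proof (cases n)
    case 0 then show ?thesis by (simp add: coboundaries_def)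
  next
    case (Suc m)
    note F = left_module_free_module[OF N.R.ring_axioms]
    have gr: "group (hom_group R (resolution R T i) N)" for i
      by (rule comm_group.axioms(2)[OF comm_group_hom_group[OF F N left_module.smult_closed[OF F]]])
    have "group_hom (hom_group R (resolution R T m) N) (hom_group R (resolution R T (Suc m)) N) (codifferential R T m)"
      by (intro group_hom.intro group_hom_axioms.intro codifferential_hom T N gr)
    then show ?thesis
      using Suc group_hom.hom_one[of _ _ "codifferential R T m"] group.is_monoid[OF gr]
      by (auto simp: coboundaries_def intro!: image_eqI[of _ _ "\<one>\<^bsub>hom_group R (resolution R T m) N\<^esub>"])
  qed
  let ?B = "coboundaries R n T N"
  let ?Z = "?H\<lparr>carrier := cocycles R n T N\<rparr>"
  have "?B #>\<^bsub>?Z\<^esub> f \<in> carrier (Ext R n T N)"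
    using f by (auto simp: Ext_def FactGroup_def RCOSETS_def)
  moreover have "carrier (Ext R n T N) = {?B}"
    using triv by (simp add: trivial_group_def Ext_def FactGroup_def)
  ultimately have "?B #>\<^bsub>?Z\<^esub> f = ?B" by simp
  moreover have "f \<in> ?B #>\<^bsub>?Z\<^esub> f"
    using one fG by (auto simp: r_coset_def intro!: bexI[of _ "\<one>\<^bsub>?H\<^esub>"])
  ultimately show ?thesis by simp
qed

text \<open>Such an \<open>f\<close> factors as \<open>g\<close> after the quotient map. The
  composite of \<open>g\<close> with the augmentation kills all boundaries, so it is a 0-cocycle and
  hence zero; the augmentation is onto, so \<open>g\<close> is zero too. This is the identification
  of \<open>Ext\<close> in degree 0 with \<open>Hom\<close>.\<close>

lemma linear_map_zero_if_Ext_0: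
  assumes X: "left_module R X" and H: "submodule H R X" and N: "left_module R N"
    and Ext: "trivial_group (Ext R 0 (quotient_module X H) N)"
    and f: "f \<in> linear_maps R X N" "\<And>x. x \<in> H \<Longrightarrow> f x = \<zero>\<^bsub>N\<^esub>"
    and x: "x \<in> carrier X"
  shows "f x = \<zero>\<^bsub>N\<^esub>"
proof -
  interpret X: left_module R X by fact
  let ?T = "quotient_module X H" and ?q = "\<lambda>x. H +>\<^bsub>X\<^esub> x"
  note Q = quotient_module_facts[OF X H]
  note F = left_module_free_module[OF X.R.ring_axioms]
  have "\<exists>g \<in> linear_maps R ?T N. \<forall>x\<in>carrier X. g (restrict ?q (carrier X) x) = f x"
  proof (rule linear_map_factor[OF X Q(1) N Q(2) _ f(1)])
    show "restrict ?q (carrier X) ` carrier X = carrier ?T" using Q(3) by simp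
    fix x assume "x \<in> carrier X" "restrict ?q (carrier X) x = \<zero>\<^bsub>?T\<^esub>"
    then have "x \<in> H" using Q(4) by auto
    then show "f x = \<zero>\<^bsub>N\<^esub>" by (rule f(2))
  qed
  then obtain g where g: "g \<in> linear_maps R ?T N" and gq: "\<And>x. x \<in> carrier X \<Longrightarrow> g (?q x) = f x" by auto
  let ?F = "resolution R ?T 0"
  define h where "h = compose (carrier ?F) g (restrict (augmentation R ?T) (carrier ?F))"
  have h: "h \<in> linear_maps R ?F N"
    unfolding h_def by (rule linear_maps_compose[OF augmentation_linear[OF Q(1)] g F])
  have hv: "h w = g (augmentation R ?T w)" if "w \<in> carrier ?F" for w
    using that by (simp add: h_def compose_def)
  have "h (differential R w) = \<zero>\<^bsub>N\<^esub>" if "w \<in> carrier (resolution R ?T (Suc 0))" for w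
  proof -
    have "differential R w \<in> carrier ?F" "augmentation R ?T (differential R w) = \<zero>\<^bsub>?T\<^esub>"
      using exact_0[OF Q(1)] that by auto
    then show ?thesis using hv linear_maps_zero[OF Q(1) N g] by simp
  qed
  then have "h \<in> cocycles R 0 ?T N"
    using h by (auto simp: cocycles_def kernel_def hom_group_def codifferential_def compose_def intro!: restrict_ext)
  then have "h \<in> coboundaries R 0 ?T N" by (rule trivial_Ext_cocycle[OF Q(1) N Ext])
  then have h0: "h w = \<zero>\<^bsub>N\<^esub>" if "w \<in> carrier ?F" for w
    using that by (simp add: coboundaries_def hom_group_def)
  have g0: "g t = \<zero>\<^bsub>N\<^esub>" if t: "t \<in> carrier ?T" for t
  proof -
    obtain w where "w \<in> carrier ?F" "t = augmentation R ?T w"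
      using t unfolding augmentation_surj[OF Q(1), symmetric] by blast
    then show ?thesis using hv h0 by simp
  qed
  have "?q x \<in> carrier ?T" unfolding Q(3)[symmetric] using x by (rule imageI)
  then show ?thesis using g0 gq[OF x] by metis
qed

lemma linear_map_extension_if_Ext_1:
  assumes X: "left_module R X" and H: "submodule H R X" and N: "left_module R N"
    and Ext: "trivial_group (Ext R 1 (quotient_module X H) N)"
    and u: "u \<in> linear_maps R (X\<lparr>carrier := H\<rparr>) N"
  shows "\<exists>v \<in> linear_maps R X N. \<forall>x\<in>H. v x = u x"
proof -
  \<comment> \<open>Lift the augmentation to \<open>\<sigma> : F\<^sub>0 \<rightarrow> X\<close>. The cocycle \<open>u \<circ> \<sigma> \<circ> d\<close> is a coboundary \<open>\<chi> \<circ> d\<close>, so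
    \<open>h + \<sigma> w \<mapsto> u h + \<chi> w\<close> is well defined on \<open>X = H + \<sigma>(F\<^sub>0)\<close>.\<close>
  interpret X: left_module R X by fact
  interpret N: left_module R N by fact
  let ?T = "quotient_module X H" and ?q = "\<lambda>x. H +>\<^bsub>X\<^esub> x"
  note Q = quotient_module_facts[OF X H] and HX = submodule_left_module[OF X H]
  note h = submodule_closed[OF H]
  interpret T: left_module R ?T by (rule Q(1))
  note r = X.R.ring_axioms and F = left_module_free_module[OF X.R.ring_axioms]
  let ?F = "resolution R ?T"
  interpret F0: left_module R "?F 0" by (rule F)
  let ?aug = "augmentation R ?T"
  note q = linear_mapsD[OF Q(2)]
  have u': "x \<in> H \<Longrightarrow> u x \<in> carrier N"
    "\<lbrakk>x \<in> H; y \<in> H\<rbrakk> \<Longrightarrow> u (x \<oplus>\<^bsub>X\<^esub> y) = u x \<oplus>\<^bsub>N\<^esub> u y"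
    "\<lbrakk>a \<in> carrier R; x \<in> H\<rbrakk> \<Longrightarrow> u (a \<odot>\<^bsub>X\<^esub> x) = a \<odot>\<^bsub>N\<^esub> u x" for x y a
    using linear_mapsD(2)[OF u, of x] linear_mapsD(3)[OF u, of x y] linear_mapsD(4)[OF u, of a x] by simp_all
  have "\<forall>t\<in>carrier ?T. \<exists>x. x \<in> carrier X \<and> ?q x = t" unfolding Q(3)[symmetric] by blast
  from bchoice[OF this]
  obtain k where k: "\<And>t. t \<in> carrier ?T \<Longrightarrow> k t \<in> carrier X \<and> ?q (k t) = t" by blast
  \<comment> \<open>On the basis of \<open>F\<^sub>0\<close>, which consists of the
    \<open>Elem t\<close>, the lift is an arbitrary choice \<open>k\<close> of coset
    representatives; the value at \<open>Rel\<close> is a mere default.\<close>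
  let ?k = "\<lambda>x. case x of Elem t \<Rightarrow> k t | Rel _ \<Rightarrow> \<zero>\<^bsub>X\<^esub>"
  have kp: "?k \<in> generators R ?T 0 \<rightarrow> carrier X" using k by (auto simp: generators.simps)
  define \<sigma> where "\<sigma> = restrict (linear_extension R X ?k) (carrier (?F 0))"
  have \<sigma>: "\<sigma> \<in> linear_maps R (?F 0) X" unfolding \<sigma>_def by (rule linear_extension_linear[OF X kp])
  note \<sigma>' = linear_mapsD[OF \<sigma>]
  \<comment> \<open>Both sides are linear in \<open>w\<close> and agree on the basis, since
    \<open>k t\<close> represents the coset \<open>t\<close>.\<close>
  have q\<sigma>: "?q (\<sigma> w) = ?aug w" if w: "w \<in> carrier (?F 0)" for w
  proof -
    have e: "compose (carrier (?F 0)) (restrict ?q (carrier X)) \<sigma> w = restrict ?aug (carrier (?F 0)) w"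
    proof (rule linear_maps_eq_on_basis[OF Q(1) linear_maps_compose[OF \<sigma> Q(2) F] augmentation_linear[OF Q(1)] _ w])
      fix x assume x: "x \<in> generators R ?T 0"
      then obtain t where t: "x = Elem t" "t \<in> carrier ?T" by (auto simp: generators.simps)
      have "\<sigma> (basis R x) = k t"
        unfolding \<sigma>_def using linear_extension_basis[OF X kp x] basis_closed[OF r x] t(1) by simp
      moreover have "?aug (basis R x) = t"
        unfolding augmentation_def
        by (subst linear_extension_basis[OF Q(1) _ x]) (auto simp: t(1) generators.simps)
      ultimately show "compose (carrier (?F 0)) (restrict ?q (carrier X)) \<sigma> (basis R x) = restrict ?aug (carrier (?F 0)) (basis R x)"
        using k[OF t(2)] basis_closed[OF r x] by (simp add: compose_def)
    qed
    then show ?thesis using w \<sigma>'(2) by (simp add: compose_def)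
  qed
  have H_iff: "?q x = \<zero>\<^bsub>?T\<^esub> \<longleftrightarrow> x \<in> H" if "x \<in> carrier X" for x using Q(4) that by blast
  let ?d = "differential R"
  have d0: "?d w \<in> carrier (?F 0)" "\<sigma> (?d w) \<in> H" if "w \<in> carrier (?F (Suc 0))" for w
  proof -
    have d: "?d w \<in> carrier (?F 0)" "?aug (?d w) = \<zero>\<^bsub>?T\<^esub>"
      using exact_0[OF Q(1)] that by blast+
    show "?d w \<in> carrier (?F 0)" by (rule d(1))
    have "?q (\<sigma> (?d w)) = \<zero>\<^bsub>?T\<^esub>" using q\<sigma>[OF d(1)] d(2) by metis
    then show "\<sigma> (?d w) \<in> H" using H_iff[OF \<sigma>'(2)[OF d(1)]] by blast
  qed
  \<comment> \<open>The map \<open>u\<close> is given on \<open>H\<close> only. The composite is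
    meaningful because the augmentation kills boundaries, so that \<open>\<sigma>\<close> sends them
    into \<open>H\<close>.\<close>
  define c where "c = (\<lambda>w\<in>carrier (?F (Suc 0)). u (\<sigma> (?d w)))"
  have c_lin: "c \<in> linear_maps R (?F (Suc 0)) N"
  proof -
    interpret F1: left_module R "?F (Suc 0)" by (rule F)
    note D = linear_mapsD(3,4)[OF differential_linear[OF r, of ?T 0]]
    show ?thesis
    proof (rule linear_mapsI)
      fix w w' assume w: "w \<in> carrier (?F (Suc 0))" "w' \<in> carrier (?F (Suc 0))"
      then have "?d (w \<oplus>\<^bsub>?F (Suc 0)\<^esub> w') = ?d w \<oplus>\<^bsub>?F 0\<^esub> ?d w'"
        using D(1)[of w w'] by simp
      then show "c (w \<oplus>\<^bsub>?F (Suc 0)\<^esub> w') = c w \<oplus>\<^bsub>N\<^esub> c w'"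
        using w u'(2)[OF d0(2)[OF w(1)] d0(2)[OF w(2)]] \<sigma>'(3)[OF d0(1)[OF w(1)] d0(1)[OF w(2)]]
        by (simp add: c_def)
    next
      fix a w assume w: "a \<in> carrier R" "w \<in> carrier (?F (Suc 0))"
      then have "?d (a \<odot>\<^bsub>?F (Suc 0)\<^esub> w) = a \<odot>\<^bsub>?F 0\<^esub> ?d w"
        using D(2)[of a w] by simp
      then show "c (a \<odot>\<^bsub>?F (Suc 0)\<^esub> w) = a \<odot>\<^bsub>N\<^esub> c w"
        using w u'(3)[OF w(1) d0(2)[OF w(2)]] \<sigma>'(4)[OF w(1) d0(1)[OF w(2)]]
        by (simp add: c_def)
    qed (use u'(1)[OF d0(2)] in \<open>auto simp: c_def\<close>)
  qed
  have "c (?d w) = \<zero>\<^bsub>N\<^esub>" if "w \<in> carrier (?F (Suc (Suc 0)))" for w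
  proof -
    have "?d w \<in> carrier (?F (Suc 0))" "?d (?d w) = \<zero>\<^bsub>?F 0\<^esub>"
      using exact_Suc[OF r, of ?T 0] that by auto
    then show ?thesis
      using linear_maps_zero[OF F X \<sigma>] linear_maps_zero[OF HX N u] by (simp add: c_def)
  qed
  then have "c \<in> cocycles R 1 ?T N"
    using c_lin by (auto simp: cocycles_def kernel_def hom_group_def codifferential_def compose_def intro!: restrict_ext)
  then have "c \<in> coboundaries R 1 ?T N" by (rule trivial_Ext_cocycle[OF Q(1) N Ext])
  then obtain \<chi> where \<chi>: "\<chi> \<in> linear_maps R (?F 0) N" and c\<chi>: "c = codifferential R ?T 0 \<chi>"
    by (auto simp: coboundaries_def hom_group_def)
  note \<chi>' = linear_mapsD[OF \<chi>]
  \<comment> \<open>If \<open>\<sigma> w\<close> lies in \<open>H\<close>, the augmentation kills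
    \<open>w\<close>, so \<open>w\<close> is a boundary \<open>?d z\<close> by exactness; the
    equation between \<open>c\<close> and the coboundary of \<open>\<chi>\<close> is then evaluated
    at \<open>z\<close>.\<close>
  have u\<sigma>: "u (\<sigma> w) = \<chi> w" if w: "w \<in> carrier (?F 0)" "\<sigma> w \<in> H" for w
  proof -
    have "?aug w = \<zero>\<^bsub>?T\<^esub>" using q\<sigma>[OF w(1)] H_iff[OF \<sigma>'(2)[OF w(1)]] w(2) by simp
    then obtain z where z: "z \<in> carrier (?F (Suc 0))" "w = ?d z"
      using exact_0[OF Q(1)] w(1) by blast
    have "c z = \<chi> (?d z)" using z(1) by (simp add: c\<chi> codifferential_def compose_def)
    then show ?thesis using z by (simp add: c_def)
  qed
  let ?Q = "\<lambda>x y. \<exists>h\<in>H. \<exists>w\<in>carrier (?F 0). x = h \<oplus>\<^bsub>X\<^esub> \<sigma> w \<and> y = u h \<oplus>\<^bsub>N\<^esub> \<chi> w"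
  \<comment> \<open>Well-definedness: if \<open>h' + \<sigma> w = 0\<close>, then
    \<open>\<sigma> w\<close> is in \<open>H\<close>, so \<open>\<chi> w\<close> may be replaced by
    \<open>u (\<sigma> w)\<close>, and the sum becomes \<open>u 0\<close>.\<close>
  have Q0: "y = \<zero>\<^bsub>N\<^esub>" if "?Q \<zero>\<^bsub>X\<^esub> y" for y
  proof -
    obtain h' w where w: "h' \<in> H" "w \<in> carrier (?F 0)" "\<zero>\<^bsub>X\<^esub> = h' \<oplus>\<^bsub>X\<^esub> \<sigma> w" "y = u h' \<oplus>\<^bsub>N\<^esub> \<chi> w"
      using \<open>?Q \<zero>\<^bsub>X\<^esub> y\<close> by blast
    have s: "\<sigma> w = \<ominus>\<^bsub>X\<^esub> h'"
      using w h(1) \<sigma>'(2) by (metis X.M.a_comm X.M.minus_equality)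
    then have sH: "\<sigma> w \<in> H" using h(5) w(1) by simp
    have "u h' \<oplus>\<^bsub>N\<^esub> \<chi> w = u (h' \<oplus>\<^bsub>X\<^esub> \<sigma> w)" using u\<sigma>[OF w(2) sH] u'(2)[OF w(1) sH] by simp
    then show ?thesis using w(3,4) linear_maps_zero[OF HX N u] by simp
  qed
  have "\<exists>v \<in> linear_maps R X N. \<forall>x\<in>carrier X. ?Q x (v x)"
  proof (rule linear_map_of_relation[OF X N])
    fix x assume x: "x \<in> carrier X"
    have "?q x \<in> ?aug ` carrier (?F 0)"
      unfolding augmentation_surj[OF Q(1)] Q(3)[symmetric] using x by (rule imageI)
    then obtain w where w: "w \<in> carrier (?F 0)" "?aug w = ?q x" by auto
    \<comment> \<open>Since \<open>w\<close> has the same image in the quotient as \<open>x\<close>,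
      the difference \<open>x - \<sigma> w\<close> lies in \<open>H\<close>; this gives the
      decomposition of \<open>x\<close>.\<close>
    let ?h = "x \<oplus>\<^bsub>X\<^esub> (\<ominus>\<^bsub>R\<^esub> \<one>\<^bsub>R\<^esub>) \<odot>\<^bsub>X\<^esub> \<sigma> w"
    have "?q ?h = \<zero>\<^bsub>?T\<^esub>"
      using q(2)[OF x] q(3)[of x "(\<ominus>\<^bsub>R\<^esub> \<one>\<^bsub>R\<^esub>) \<odot>\<^bsub>X\<^esub> \<sigma> w"] q(4)[of "\<ominus>\<^bsub>R\<^esub> \<one>\<^bsub>R\<^esub>" "\<sigma> w"] x w \<sigma>'(2)
      by (simp add: q\<sigma> T.smult_minus_one T.M.r_neg)
    then have "?h \<in> H" using H_iff x w(1) \<sigma>'(2) by auto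
    moreover have "x = ?h \<oplus>\<^bsub>X\<^esub> \<sigma> w"
      using x w(1) \<sigma>'(2) by (simp add: X.smult_minus_one X.M.a_assoc X.M.l_neg)
    ultimately show "\<exists>y\<in>carrier N. ?Q x y"
      using w(1) u'(1) \<chi>'(2) by (intro bexI[of _ "u ?h \<oplus>\<^bsub>N\<^esub> \<chi> w"]) auto
  next
    fix x x' y y' assume "?Q x y" "?Q x' y'"
    then obtain h1 w1 h2 w2 where w: "h1 \<in> H" "w1 \<in> carrier (?F 0)" "h2 \<in> H" "w2 \<in> carrier (?F 0)"
      and e: "x = h1 \<oplus>\<^bsub>X\<^esub> \<sigma> w1" "y = u h1 \<oplus>\<^bsub>N\<^esub> \<chi> w1" "x' = h2 \<oplus>\<^bsub>X\<^esub> \<sigma> w2" "y' = u h2 \<oplus>\<^bsub>N\<^esub> \<chi> w2" by blast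
    have "x \<oplus>\<^bsub>X\<^esub> x' = (h1 \<oplus>\<^bsub>X\<^esub> h2) \<oplus>\<^bsub>X\<^esub> \<sigma> (w1 \<oplus>\<^bsub>?F 0\<^esub> w2)"
      using w h(1) \<sigma>'(2) by (simp add: e \<sigma>'(3) X.M.a_ac)
    moreover have "y \<oplus>\<^bsub>N\<^esub> y' = u (h1 \<oplus>\<^bsub>X\<^esub> h2) \<oplus>\<^bsub>N\<^esub> \<chi> (w1 \<oplus>\<^bsub>?F 0\<^esub> w2)"
      using w u'(1) \<chi>'(2) by (simp add: e \<chi>'(3) u'(2) N.M.a_ac)
    ultimately show "?Q (x \<oplus>\<^bsub>X\<^esub> x') (y \<oplus>\<^bsub>N\<^esub> y')" using w h(3) F0.M.a_closed by blast
  next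
    fix a x y assume a: "a \<in> carrier R" and "?Q x y"
    then obtain h1 w1 where w: "h1 \<in> H" "w1 \<in> carrier (?F 0)"
      and e: "x = h1 \<oplus>\<^bsub>X\<^esub> \<sigma> w1" "y = u h1 \<oplus>\<^bsub>N\<^esub> \<chi> w1" by blast
    have "a \<odot>\<^bsub>X\<^esub> x = (a \<odot>\<^bsub>X\<^esub> h1) \<oplus>\<^bsub>X\<^esub> \<sigma> (a \<odot>\<^bsub>?F 0\<^esub> w1)"
      using a w h(1) \<sigma>'(2) by (simp add: e \<sigma>'(4) X.smult_r_distr)
    moreover have "a \<odot>\<^bsub>N\<^esub> y = u (a \<odot>\<^bsub>X\<^esub> h1) \<oplus>\<^bsub>N\<^esub> \<chi> (a \<odot>\<^bsub>?F 0\<^esub> w1)"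
      using a w u'(1) \<chi>'(2) by (simp add: e \<chi>'(4) u'(3) N.smult_r_distr)
    ultimately show "?Q (a \<odot>\<^bsub>X\<^esub> x) (a \<odot>\<^bsub>N\<^esub> y)" using a w h(4) F0.smult_closed by blast
  qed (rule Q0)
  then obtain v where v: "v \<in> linear_maps R X N" "\<And>x. x \<in> carrier X \<Longrightarrow> ?Q x (v x)" by blast
  \<comment> \<open>The decomposition of \<open>x\<close> supplied by the relation need not be the
    trivial one. Its part \<open>\<sigma> w = x - h'\<close> is still in \<open>H\<close>, where
    \<open>\<chi> w\<close> equals \<open>u (\<sigma> w)\<close>.\<close>
  have "v x = u x" if x: "x \<in> H" for x
  proof -
    obtain h' w where w: "h' \<in> H" "w \<in> carrier (?F 0)" "x = h' \<oplus>\<^bsub>X\<^esub> \<sigma> w" "v x = u h' \<oplus>\<^bsub>N\<^esub> \<chi> w"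
      using v(2)[OF h(1)[OF x]] by blast
    have "\<sigma> w = \<ominus>\<^bsub>X\<^esub> h' \<oplus>\<^bsub>X\<^esub> x" using w h(1) \<sigma>'(2) by (simp add: X.M.r_neg1)
    then have sH: "\<sigma> w \<in> H" using h(3,5) w(1) x by simp
    show ?thesis using w(3,4) u\<sigma>[OF w(2) sH] u'(2)[OF w(1) sH] by simp
  qed
  then show ?thesis using v(1) by blast
qed

section \<open>Finite dual bases, torsionless modules and retracts\<close>

text \<open>The free module in the definition of \<open>projective\<close> may have infinite rank.
  Lifting the identity of \<open>P\<close> through the surjection from the free module on a finite
  generating set gives a section \<open>s\<close> with finitely many coordinates; together with the
  generators these form a dual basis.\<close>

lemma finitely_generated_projective_dual_basis:
  assumes P: "projective R P" and fg: "finitely_generated R P"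
  shows "\<exists>S. finite S \<and> S \<subseteq> carrier P \<and> (\<exists>s \<in> linear_maps R P (free_module R S).
    \<forall>x\<in>carrier P. linear_extension R P (\<lambda>p. p) (s x) = x)"
proof -
  have P': "left_module R P" using P by (simp add: projective_def)
  interpret P: left_module R P by (rule P')
  note r = P.R.ring_axioms
  obtain S where S: "S \<subseteq> carrier P" "finite S"
    and gen: "\<And>x. x \<in> carrier P \<Longrightarrow> \<exists>c \<in> S \<rightarrow> carrier R. x = (\<Oplus>\<^bsub>P\<^esub>s\<in>S. c s \<odot>\<^bsub>P\<^esub> s)"
    using fg unfolding finitely_generated_def by blast
  let ?F = "free_module R S"
  have i: "(\<lambda>p. p) \<in> S \<rightarrow> carrier P" using S by auto
  let ?g = "restrict (linear_extension R P (\<lambda>p. p)) (carrier ?F)"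
  have g: "?g \<in> linear_maps R ?F P" by (rule linear_extension_linear[OF P' i])
  have "x \<in> ?g ` carrier ?F" if x: "x \<in> carrier P" for x
  proof -
    obtain c where c: "c \<in> S \<rightarrow> carrier R" "x = (\<Oplus>\<^bsub>P\<^esub>s\<in>S. c s \<odot>\<^bsub>P\<^esub> s)" using gen[OF x] by blast
    \<comment> \<open>The coefficients are constrained on \<open>S\<close> only, whereas elements of
      \<open>?F\<close> must vanish outside \<open>S\<close>.\<close>
    let ?c = "\<lambda>s. if s \<in> S then c s else \<zero>\<^bsub>R\<^esub>"
    have cF: "?c \<in> carrier ?F"
      using c(1) S(2) by (auto simp: free_module_def intro: finite_subset[OF _ S(2)])
    have "linear_extension R P (\<lambda>p. p) ?c = (\<Oplus>\<^bsub>P\<^esub>s\<in>S. ?c s \<odot>\<^bsub>P\<^esub> s)"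
      by (rule linear_extension_eq[OF P' cF i S(2)]) auto
    also have "\<dots> = x" unfolding c(2)
      by (rule P.M.finsum_cong') (use c(1) S(1) in auto)
    finally show ?thesis using cF by (intro image_eqI[of _ _ ?c]) auto
  qed
  then have "?g ` carrier ?F = carrier P" using linear_mapsD(2)[OF g] by blast
  moreover have "restrict (\<lambda>x. x) (carrier P) \<in> linear_maps R P P" by (rule linear_mapsI) auto
  ultimately obtain s where s: "s \<in> linear_maps R P ?F" "\<And>x. x \<in> carrier P \<Longrightarrow> ?g (s x) = x"
    using projective_lifting[OF P left_module_free_module[OF r] P' g] by (metis (no_types, lifting) restrict_apply')
  then have "\<forall>x\<in>carrier P. linear_extension R P (\<lambda>p. p) (s x) = x"
    using linear_mapsD(2)[OF s(1)] by (metis restrict_apply')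
  then show ?thesis using S s(1) by blast
qed

text \<open>The Ext condition concerns maps into \<open>R\<close> only. In terms of the dual basis,
  \<open>e\<close> consists of the coordinate maps \<open>s (e x) p\<close> into \<open>R\<close>;
  each of them extends to \<open>P\<close>, and the extensions are reassembled over the finite set
  \<open>S\<close>.\<close>

lemma endomorphism_extension_if_Ext_1:
  assumes P: "projective R P" "finitely_generated R P" and H: "submodule H R P"
    and Ext: "trivial_group (Ext R 1 (quotient_module P H) (regular_module R))"
    and e: "e \<in> linear_maps R (P\<lparr>carrier := H\<rparr>) P"
  shows "\<exists>E \<in> linear_maps R P P. \<forall>x\<in>H. E x = e x"
proof -
  have P': "left_module R P" using P by (simp add: projective_def)
  interpret P: left_module R P by (rule P')
  note r = P.R.ring_axioms
  obtain S s where S: "finite S" "S \<subseteq> carrier P" and s: "s \<in> linear_maps R P (free_module R S)"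
    and ss: "\<And>x. x \<in> carrier P \<Longrightarrow> linear_extension R P (\<lambda>p. p) (s x) = x"
    using finitely_generated_projective_dual_basis[OF P] by blast
  note s' = linear_mapsD[OF s] and e' = linear_mapsD[OF e, simplified]
  note h = submodule_closed[OF H]
  have "\<exists>v \<in> linear_maps R P (regular_module R). \<forall>x\<in>H. v x = s (e x) p" for p
  proof -
    have "(\<lambda>x\<in>H. s (e x) p) \<in> linear_maps R (P\<lparr>carrier := H\<rparr>) (regular_module R)"
    proof (rule linear_mapsI)
      show "(\<lambda>x\<in>H. s (e x) p) x \<in> carrier (regular_module R)" if "x \<in> carrier (P\<lparr>carrier := H\<rparr>)" for x
        using s'(2)[OF e'(2), of x] that by (auto simp: free_module_def regular_module_def)
    qed (use h(3,4) in \<open>auto simp: e' s', auto simp: free_module_def regular_module_def\<close>)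
    from linear_map_extension_if_Ext_1[OF P' H left_module_regular_module[OF r] Ext this]
    show ?thesis by auto
  qed
  then obtain v where v: "\<And>p. v p \<in> linear_maps R P (regular_module R)" "\<And>p x. x \<in> H \<Longrightarrow> v p x = s (e x) p"
    by metis
  \<comment> \<open>Outside \<open>S\<close> the extension \<open>v p\<close> is known to vanish on
    \<open>H\<close> only, so the value there is set to zero. The finiteness of \<open>S\<close>
    then gives finite support.\<close>
  define G where "G = (\<lambda>x\<in>carrier P. \<lambda>p. if p \<in> S then v p x else \<zero>\<^bsub>R\<^esub>)"
  have G: "G \<in> linear_maps R P (free_module R S)"
  proof (rule linear_mapsI)
    fix x assume x: "x \<in> carrier P"
    have "finite {p. (if p \<in> S then v p x else \<zero>\<^bsub>R\<^esub>) \<noteq> \<zero>\<^bsub>R\<^esub>}"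
      by (rule finite_subset[OF _ S(1)]) auto
    then show "G x \<in> carrier (free_module R S)"
      using x linear_mapsD(2)[OF v(1)] by (simp add: free_module_def G_def regular_module_def)
  qed (auto simp: G_def linear_mapsD(3,4)[OF v(1)] free_module_def regular_module_def fun_eq_iff)
  have i: "(\<lambda>p. p) \<in> S \<rightarrow> carrier P" using S by auto
  let ?L = "restrict (linear_extension R P (\<lambda>p. p)) (carrier (free_module R S))"
  have "compose (carrier P) ?L G \<in> linear_maps R P P"
    by (rule linear_maps_compose[OF G linear_extension_linear[OF P' i] P'])
  moreover have "compose (carrier P) ?L G x = e x" if x: "x \<in> H" for x
  proof -
    have "G x = s (e x)"
      using v(2)[OF x] h(1)[OF x] s'(2)[OF e'(2)[OF x]] by (auto simp: G_def free_module_def fun_eq_iff)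
    then show ?thesis using h(1)[OF x] ss[OF e'(2)[OF x]] s'(2)[OF e'(2)[OF x]] by (simp add: compose_def)
  qed
  ultimately show ?thesis by blast
qed

text \<open>The coordinates of an embedding into a direct power of \<open>R\<close> are linear forms
  on \<open>M\<close>, so linear forms separate the elements of \<open>M\<close> from zero.\<close>

lemma torsionless_linear_map_zero:
  assumes M: "left_module R M" and tl: "torsionless TYPE('i) R M"
    and f: "f \<in> linear_maps R X M" and x: "x \<in> carrier X"
    and zero: "\<And>g. g \<in> linear_maps R M (regular_module R) \<Longrightarrow> g (f x) = \<zero>\<^bsub>R\<^esub>"
  shows "f x = \<zero>\<^bsub>M\<^esub>"
proof -
  interpret M: left_module R M by fact
  obtain I :: "'i set" and j where j: "j \<in> linear_maps R M (direct_power R I)" "inj_on j (carrier M)"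
    using tl unfolding torsionless_def by blast
  note j' = linear_mapsD[OF j(1)]
  have fx: "f x \<in> carrier M" using linear_mapsD(2)[OF f x] .
  have "j (f x) i = \<zero>\<^bsub>R\<^esub>" if i: "i \<in> I" for i
  proof -
    have "(\<lambda>y\<in>carrier M. j y i) \<in> linear_maps R M (regular_module R)"
    proof (rule linear_mapsI)
      show "(\<lambda>y\<in>carrier M. j y i) y \<in> carrier (regular_module R)" if "y \<in> carrier M" for y
        using j'(2)[OF that] i that by (auto simp: direct_power_def regular_module_def)
    qed (auto simp: j'(3,4), auto simp: direct_power_def regular_module_def i)
    from zero[OF this] show ?thesis using fx by simp
  qed
  then have "j (f x) = j \<zero>\<^bsub>M\<^esub>"
    using j'(2)[OF fx] linear_maps_zero[OF M left_module_direct_power[OF M.R.ring_axioms] j(1)]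
    by (auto simp: direct_power_def fun_eq_iff PiE_def extensional_def)
  then show ?thesis using j(2) fx by (auto dest: inj_onD)
qed

text \<open>The lifting property passes to retracts: a lift of \<open>f\<close> composed with
  \<open>p\<close>, preceded by \<open>s\<close>, is a lift of \<open>f\<close>.\<close>

lemma projective_retract:
  fixes P :: "('r, 'p, 'x) module_scheme" and M :: "('r, 'm, 'y) module_scheme"
  assumes P: "projective R P" and M: "left_module R M"
    and p: "p \<in> linear_maps R P M" and s: "s \<in> linear_maps R M P" "\<And>x. x \<in> carrier M \<Longrightarrow> p (s x) = x"
  shows "projective R M"
proof (rule projective_if_lifting[OF M])
  have P': "left_module R P" using P by (simp add: projective_def)
  fix A :: "('r, 'm \<Rightarrow> 'r) module" and g f
  assume A: "left_module R A" "g \<in> linear_maps R A M" "g ` carrier A = carrier M" and f: "f \<in> linear_maps R M M"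
  obtain h where h: "h \<in> linear_maps R P A" "\<And>x. x \<in> carrier P \<Longrightarrow> g (h x) = compose (carrier P) f p x"
    using projective_lifting[OF P A(1) M A(2,3) linear_maps_compose[OF p f P']] by blast
  show "\<exists>h \<in> linear_maps R M A. \<forall>x\<in>carrier M. g (h x) = f x"
    by (rule bexI[OF _ linear_maps_compose[OF s(1) h(1) M]])
      (use h(2) s(2) linear_mapsD(2)[OF s(1)] in \<open>auto simp: compose_def\<close>)
qed

section \<open>Splitting the epimorphism onto the torsionless module\<close>

theorem theorem4p1:
  fixes R :: "('r, 'z) ring_scheme" and M :: "('r, 'm, 'x) module_scheme"
  assumes "ring R" and "left_module R M"
    and "finitely_generated R M"
    and "torsionless TYPE('i) R M"
    and "projective_up_to_grade TYPE('p) 2 R M"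
  shows "projective R M"
proof -
  note M = assms(2) and reg = left_module_regular_module[OF assms(1)]
  obtain P :: "('r, 'p) module" and \<pi> B where P: "projective R P" and fg: "finitely_generated R P"
    and \<pi>: "\<pi> \<in> linear_maps R P M" "\<pi> ` carrier P = carrier M" and B: "submodule B R P"
    and AB: "a_kernel P M \<pi> \<inter> B = {\<zero>\<^bsub>P\<^esub>}"
    and gr: "grade_at_least 2 R (quotient_module P (a_kernel P M \<pi> <+>\<^bsub>P\<^esub> B))"
    using assms(3,5) unfolding projective_up_to_grade_def by blast
  have P': "left_module R P" using P by (simp add: projective_def)
  interpret M: left_module R M by (rule M)
  interpret P: left_module R P by (rule P')
  define A where "A = a_kernel P M \<pi>"
  have A_iff: "x \<in> A \<longleftrightarrow> x \<in> carrier P \<and> \<pi> x = \<zero>\<^bsub>M\<^esub>" for x by (simp add: A_def a_kernel_def')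
  have A: "submodule A R P" unfolding A_def by (rule submodule_kernel[OF P' M \<pi>(1)])
  let ?H = "A <+>\<^bsub>P\<^esub> B"
  have H: "submodule ?H R P" by (rule submodule_set_add[OF P' A B])
  \<comment> \<open>Grade at least 2 covers the degrees 0 and 1: degree 1 provides the extension
    \<open>E\<close>, degree 0 forces its values into \<open>A\<close>.\<close>
  have Ext: "trivial_group (Ext R 0 (quotient_module P ?H) (regular_module R))"
    "trivial_group (Ext R 1 (quotient_module P ?H) (regular_module R))"
    using gr unfolding grade_at_least_def A_def by (auto simp del: One_nat_def)
  obtain e where e: "e \<in> linear_maps R (P\<lparr>carrier := ?H\<rparr>) (P\<lparr>carrier := A\<rparr>)" "\<And>x. x \<in> A \<Longrightarrow> e x = x"
    using projection_of_trivial_intersection[OF P' A B] AB unfolding A_def by blast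
  note e' = linear_mapsD[OF e(1), simplified]
  \<comment> \<open>The codomain is widened from \<open>A\<close> to \<open>P\<close>, because the
    dual basis through which the map is extended belongs to \<open>P\<close>.\<close>
  have "e \<in> linear_maps R (P\<lparr>carrier := ?H\<rparr>) P"
    by (rule linear_mapsI) (use e' A_iff in auto)
  then obtain E where E: "E \<in> linear_maps R P P" "\<And>x. x \<in> ?H \<Longrightarrow> E x = e x"
    using endomorphism_extension_if_Ext_1[OF P fg H Ext(2)] by blast
  note E' = linear_mapsD[OF E(1)]
  note \<pi>E = linear_maps_compose[OF E(1) \<pi>(1) P']
  \<comment> \<open>The extension was made inside \<open>P\<close>, so its values outside
    \<open>?H\<close> have yet to be placed in \<open>A\<close>. On \<open>?H\<close> it agrees with
    \<open>e\<close>, whose values lie in the kernel of \<open>\<pi>\<close>; thus every linear form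
    on \<open>M\<close> composed with \<open>\<pi>\<close> and \<open>E\<close> vanishes on
    \<open>?H\<close>, and hence everywhere.\<close>
  have EA: "E x \<in> A" if x: "x \<in> carrier P" for x
  proof -
    have "compose (carrier P) \<pi> E x = \<zero>\<^bsub>M\<^esub>"
    proof (rule torsionless_linear_map_zero[OF M assms(4) \<pi>E x])
      fix g assume g: "g \<in> linear_maps R M (regular_module R)"
      have "compose (carrier P) g (compose (carrier P) \<pi> E) y = \<zero>\<^bsub>regular_module R\<^esub>" if y: "y \<in> ?H" for y
      proof -
        have "y \<in> carrier P" "\<pi> (E y) = \<zero>\<^bsub>M\<^esub>"
          using submodule_closed(1)[OF H y] E(2)[OF y] e'(2)[OF y] A_iff by auto
        then show ?thesis using linear_maps_zero[OF M reg g] by (simp add: compose_def)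
      qed
      from linear_map_zero_if_Ext_0[OF P' H reg Ext(1) linear_maps_compose[OF \<pi>E g P'] this x]
      show "g (compose (carrier P) \<pi> E x) = \<zero>\<^bsub>R\<^esub>" using x by (simp add: compose_def regular_module_def)
    qed
    then show ?thesis using x E'(2) by (simp add: A_iff compose_def)
  qed
  have E_id: "E x = x" if x: "x \<in> A" for x
  proof -
    have "x = x \<oplus>\<^bsub>P\<^esub> \<zero>\<^bsub>P\<^esub>" using x A_iff by simp
    then have "x \<in> ?H" using x submodule_closed(2)[OF B] by (auto simp: set_add_def')
    then show ?thesis using E(2) e(2) x by simp
  qed
  \<comment> \<open>\<open>D\<close> is the identity minus \<open>E\<close>. It kills
    \<open>A\<close>, on which \<open>E\<close> is the identity, so it factors through
    \<open>\<pi>\<close>. It changes \<open>x\<close> only by an element of \<open>A\<close>, so the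
    induced map \<open>s\<close> is a section of \<open>\<pi>\<close>.\<close>
  define D where "D = (\<lambda>x\<in>carrier P. x \<oplus>\<^bsub>P\<^esub> \<ominus>\<^bsub>P\<^esub> E x)"
  have neg: "\<ominus>\<^bsub>P\<^esub> (a \<odot>\<^bsub>P\<^esub> x) = a \<odot>\<^bsub>P\<^esub> (\<ominus>\<^bsub>P\<^esub> x)" if "a \<in> carrier R" "x \<in> carrier P" for a x
    using that by (intro P.M.minus_equality) (simp_all add: P.smult_r_distr[symmetric] P.M.l_neg)
  have D: "D \<in> linear_maps R P P"
    by (rule linear_mapsI)
      (auto simp: D_def E' neg P.smult_r_distr P.M.minus_add P.M.a_ac)
  obtain s where s: "s \<in> linear_maps R M P" "\<And>x. x \<in> carrier P \<Longrightarrow> s (\<pi> x) = D x"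
    using linear_map_factor[OF P' M P' \<pi> D] E_id A_iff by (auto simp: D_def P.M.r_neg)
  show ?thesis
  proof (rule projective_retract[OF P M \<pi>(1) s(1)])
    fix y assume "y \<in> carrier M"
    then obtain x where x: "x \<in> carrier P" "y = \<pi> x" using \<pi>(2) by blast
    have "\<ominus>\<^bsub>P\<^esub> E x \<in> A" using submodule_closed(5)[OF A EA[OF x(1)]] .
    then have "\<pi> (D x) = \<pi> x"
      using x(1) linear_mapsD(2,3)[OF \<pi>(1)] A_iff by (simp add: D_def)
    then show "\<pi> (s y) = y" using s(2) x by simp
  qed
qed

end
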